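(* Let $\mathsf{V},\mathsf{W}$ be cartesian closed categories with chosen finite coproducts $n_{\mathsf V}$, $n_{\mathsf W}$ ($n\in\mathbb N$) of their terminal objects, and let $F\colon\mathsf V\to\mathsf W$ be a cartesian functor (i.e. a functor preserving finite products) that preserves these chosen coproducts. Then $F_*$ preserves enriched theories: for every $\mathsf V$-theory $\tau_{\mathsf V}\colon\mathsf A_{\mathsf V}\to\mathsf T$, the $\mathsf W$-functor $$\tau_{\mathsf W}:=F_*(\tau_{\mathsf V})\circ\tilde F\colon\mathsf A_{\mathsf W}\to F_*(\mathsf T)$$ is a $\mathsf W$-theory. Moreover, $F_*$ preserves models: for every model $\mu\colon\mathsf T\to\mathsf C$ of $(\mathsf T,\tau_{\mathsf V})$, the $\mathsf W$-functor $F_*(\mu)\colon F_*(\mathsf T)\to F_*(\mathsf C)$ is a model of $(F_*(\mathsf T),\tau_{\mathsf W})$.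
   Context: For a cartesian closed category $\mathsf V$ with chosen finite coproducts $n_{\mathsf V}=\sum_{i\in n}1_{\mathsf V}$ of the terminal object $1_{\mathsf V}$: $\mathsf N_{\mathsf V}$ is the full subcategory of $\mathsf V$ containing just the objects $n_{\mathsf V}$, and $\underline{\mathsf N}_{\mathsf V}$ is the $\mathsf V$-category with the same objects as $\mathsf N_{\mathsf V}$ and with hom-objects given by the exponentials in $\mathsf V$, $\underline{\mathsf N}_{\mathsf V}(m_{\mathsf V},n_{\mathsf V})=n_{\mathsf V}^{m_{\mathsf V}}$, which in $\mathsf N_{\mathsf V}$ is $(n^m)_{\mathsf V}$. The $\mathsf V$-category of arities is $\mathsf A_{\mathsf V}:=\underline{\mathsf N}_{\mathsf V}^{\mathrm{op}}$. A universal cone exhibiting an object $b$ of a $\mathsf V$-category $\mathsf C$ as the $\mathsf V$-product of $b_1,\dots,b_n$ is a morphism $p\colon1_{\mathsf V}\to\prod_{i=1}^n\mathsf C(b,b_i)$ such that the $\mathsf V$-natural transformation $\mathsf C(-,b)\to\prod_i\mathsf C(-,b_i)$ obtained from $p$ by composition is an isomorphism. A $\mathsf V$-functor preserves finite $\mathsf V$-products if it sends all such universal cones ($n\ge0$) to universal cones. A $\mathsf V$-theory $(\mathsf T,\tau)$ is a $\mathsf V$-category $\mathsf T$ equipped with a $\mathsf V$-functor $\tau\colon\mathsf A_{\mathsf V}\to\mathsf T$ that is the identity on objects and preserves finite $\mathsf V$-products. A model of $(\mathsf T,\tau)$ in a $\mathsf V$-category $\mathsf C$ is a $\mathsf V$-functor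 $\mathsf T\to\mathsf C$ that preserves finite $\mathsf V$-products. The same definitions apply to $\mathsf W$. That $F$ preserves the chosen finite coproducts of the terminal object means $F(n_{\mathsf V})=n_{\mathsf W}$ for all $n$. The change of base $F_*\colon\mathsf V\mathsf{Cat}\to\mathsf W\mathsf{Cat}$ takes a $\mathsf V$-category $\mathsf C$ to the $\mathsf W$-category $F_*(\mathsf C)$ with the same objects and hom-objects $F_*(\mathsf C)(a,b)=F(\mathsf C(a,b))$, with composition and identities obtained by applying $F$ and using $F(x)\times F(y)\cong F(x\times y)$ and $1_{\mathsf W}\cong F(1_{\mathsf V})$; for a $\mathsf V$-functor $f$, the $\mathsf W$-functor $F_*(f)$ equals $f$ on objects and $F(f)$ on hom-objects. $\tilde F\colon\mathsf A_{\mathsf W}\to F_*(\mathsf A_{\mathsf V})$ is the isomorphism of $\mathsf W$-categories that maps $n_{\mathsf W}$ to $n_{\mathsf V}$ on objects and on hom-objects is the identity from $\mathsf A_{\mathsf W}(m_{\mathsf W},n_{\mathsf W})=m_{\mathsf W}^{n_{\mathsf W}}=(m^n)_{\mathsf W}$ to $F(\mathsf A_{\mathsf V}(m_{\mathsf V},n_{\mathsf V}))=F(m_{\mathsf V}^{n_{\mathsf V}})=F((m^n)_{\mathsf V})=(m^n)_{\mathsf W}$. In saying that $\tau_{\mathsf W}$ is the identity on objects, $\tilde F$ is regarded as the identity on objects, $n_{\mathsf W}$ being matched with $n_{\mathsf V}$.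
   Formalization: F preserving the chosen coproducts is taken to include the coprojections (up to 1_W ≅ F(1_V)), not only F(n_V)=n_W; with object equality alone F could permute summands and F̃ would not be a W-functor. Objects n_V of the arity category are indexed by the numbers n. *)

theory Defs
  imports Main
begin

section \<open>Categories\<close>

record ('o, 'a) cat =
  Obj :: "'o set"
  Arr :: "'a set"
  Src :: "'a \<Rightarrow> 'o"
  Tgt :: "'a \<Rightarrow> 'o"
  Idn :: "'o \<Rightarrow> 'a"
  Cmp :: "'a \<Rightarrow> 'a \<Rightarrow> 'a"  (infixr "\<odot>\<index>" 70)

definition hom :: "('o, 'a, 'r) cat_scheme \<Rightarrow> 'o \<Rightarrow> 'o \<Rightarrow> 'a set" where
  "hom C x y = {f \<in> Arr C. Src C f = x \<and> Tgt C f = y}"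

locale category =
  fixes C :: "('o, 'a, 'r) cat_scheme" (structure)
  assumes src_in: "f \<in> Arr C \<Longrightarrow> Src C f \<in> Obj C"
    and tgt_in: "f \<in> Arr C \<Longrightarrow> Tgt C f \<in> Obj C"
    and idn_hom: "x \<in> Obj C \<Longrightarrow> Idn C x \<in> hom C x x"
    and cmp_hom: "\<lbrakk>f \<in> hom C x y; g \<in> hom C y z\<rbrakk> \<Longrightarrow> g \<odot> f \<in> hom C x z"
    and idn_left: "f \<in> hom C x y \<Longrightarrow> Idn C y \<odot> f = f"
    and idn_right: "f \<in> hom C x y \<Longrightarrow> f \<odot> Idn C x = f"
    and cmp_assoc: "\<lbrakk>f \<in> hom C w x; g \<in> hom C x y; h \<in> hom C y z\<rbrakk>
        \<Longrightarrow> (h \<odot> g) \<odot> f = h \<odot> (g \<odot> f)"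

definition is_iso :: "('o, 'a, 'r) cat_scheme \<Rightarrow> 'a \<Rightarrow> bool" where
  "is_iso C f \<longleftrightarrow> f \<in> Arr C \<and>
    (\<exists>g \<in> hom C (Tgt C f) (Src C f).
      g \<odot>\<^bsub>C\<^esub> f = Idn C (Src C f) \<and> f \<odot>\<^bsub>C\<^esub> g = Idn C (Tgt C f))"

text \<open>Finite families of objects are lists \<open>xs\<close>; the legs of a (co)cone are indexed by
  the positions \<open>i < length xs\<close>. The empty list gives terminal and initial objects.\<close>

definition is_product ::
  "('o, 'a, 'r) cat_scheme \<Rightarrow> 'o list \<Rightarrow> 'o \<Rightarrow> (nat \<Rightarrow> 'a) \<Rightarrow> bool" where
  "is_product C xs p \<pi> \<longleftrightarrow>
    p \<in> Obj C \<and> (\<forall>i < length xs. \<pi> i \<in> hom C p (xs ! i)) \<and>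
    (\<forall>z \<in> Obj C. \<forall>f. (\<forall>i < length xs. f i \<in> hom C z (xs ! i)) \<longrightarrow>
      (\<exists>!h. h \<in> hom C z p \<and> (\<forall>i < length xs. \<pi> i \<odot>\<^bsub>C\<^esub> h = f i)))"

definition is_coproduct ::
  "('o, 'a, 'r) cat_scheme \<Rightarrow> 'o list \<Rightarrow> 'o \<Rightarrow> (nat \<Rightarrow> 'a) \<Rightarrow> bool" where
  "is_coproduct C xs s \<iota> \<longleftrightarrow>
    s \<in> Obj C \<and> (\<forall>i < length xs. \<iota> i \<in> hom C (xs ! i) s) \<and>
    (\<forall>z \<in> Obj C. \<forall>f. (\<forall>i < length xs. f i \<in> hom C (xs ! i) z) \<longrightarrow>
      (\<exists>!h. h \<in> hom C s z \<and> (\<forall>i < length xs. h \<odot>\<^bsub>C\<^esub> \<iota> i = f i)))"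


section \<open>Cartesian closed categories with chosen copowers of the terminal object\<close>

text \<open>\<open>Prd V xs\<close> with projections \<open>Prj V xs i\<close> is the chosen product of the list \<open>xs\<close>;
  \<open>Num V n\<close> with coprojections \<open>Inj V n i\<close> is the chosen coproduct \<open>n\<^sub>V\<close>
  of \<open>n\<close> copies of the terminal object.\<close>

record ('o, 'a) num_cat = "('o, 'a) cat" +
  Prd :: "'o list \<Rightarrow> 'o"
  Prj :: "'o list \<Rightarrow> nat \<Rightarrow> 'a"
  Num :: "nat \<Rightarrow> 'o"
  Inj :: "nat \<Rightarrow> nat \<Rightarrow> 'a"

abbreviation one :: "('o, 'a, 'r) num_cat_scheme \<Rightarrow> 'o" where
  "one V \<equiv> Prd V []"

abbreviation prod2 :: "('o, 'a, 'r) num_cat_scheme \<Rightarrow> 'o \<Rightarrow> 'o \<Rightarrow> 'o" where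
  "prod2 V x y \<equiv> Prd V [x, y]"

abbreviation pr1 :: "('o, 'a, 'r) num_cat_scheme \<Rightarrow> 'o \<Rightarrow> 'o \<Rightarrow> 'a" where
  "pr1 V x y \<equiv> Prj V [x, y] 0"

abbreviation pr2 :: "('o, 'a, 'r) num_cat_scheme \<Rightarrow> 'o \<Rightarrow> 'o \<Rightarrow> 'a" where
  "pr2 V x y \<equiv> Prj V [x, y] 1"

text \<open>The morphism from \<open>z\<close> into the chosen product of the targets of \<open>fs\<close>. The source is
  an argument because it cannot be read off from an empty list.\<close>

definition tuple :: "('o, 'a, 'r) num_cat_scheme \<Rightarrow> 'o \<Rightarrow> 'a list \<Rightarrow> 'a" where
  "tuple V z fs = (THE h. h \<in> hom V z (Prd V (map (Tgt V) fs)) \<and>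
    (\<forall>i < length fs. Prj V (map (Tgt V) fs) i \<odot>\<^bsub>V\<^esub> h = fs ! i))"

definition bang :: "('o, 'a, 'r) num_cat_scheme \<Rightarrow> 'o \<Rightarrow> 'a" where
  "bang V z = tuple V z []"

definition pair :: "('o, 'a, 'r) num_cat_scheme \<Rightarrow> 'a \<Rightarrow> 'a \<Rightarrow> 'a" where
  "pair V f g = tuple V (Src V f) [f, g]"

definition pmap :: "('o, 'a, 'r) num_cat_scheme \<Rightarrow> 'a \<Rightarrow> 'a \<Rightarrow> 'a" where
  "pmap V f g = pair V (f \<odot>\<^bsub>V\<^esub> pr1 V (Src V f) (Src V g)) (g \<odot>\<^bsub>V\<^esub> pr2 V (Src V f) (Src V g))"

definition assoc :: "('o, 'a, 'r) num_cat_scheme \<Rightarrow> 'o \<Rightarrow> 'o \<Rightarrow> 'o \<Rightarrow> 'a" where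
  "assoc V x y z =
    pair V (pr1 V x y \<odot>\<^bsub>V\<^esub> pr1 V (prod2 V x y) z)
      (pair V (pr2 V x y \<odot>\<^bsub>V\<^esub> pr1 V (prod2 V x y) z) (pr2 V (prod2 V x y) z))"

definition swap :: "('o, 'a, 'r) num_cat_scheme \<Rightarrow> 'o \<Rightarrow> 'o \<Rightarrow> 'a" where
  "swap V x y = pair V (pr2 V x y) (pr1 V x y)"

text \<open>\<open>e\<close> with evaluation \<open>\<epsilon> : e \<times> b \<rightarrow> c\<close> is an exponential of \<open>c\<close> by \<open>b\<close>.\<close>

definition is_exponential ::
  "('o, 'a, 'r) num_cat_scheme \<Rightarrow> 'o \<Rightarrow> 'o \<Rightarrow> 'o \<Rightarrow> 'a \<Rightarrow> bool" where
  "is_exponential V b c e \<epsilon> \<longleftrightarrow>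
    e \<in> Obj V \<and> \<epsilon> \<in> hom V (prod2 V e b) c \<and>
    (\<forall>z \<in> Obj V. \<forall>f \<in> hom V (prod2 V z b) c.
      \<exists>!h. h \<in> hom V z e \<and> \<epsilon> \<odot>\<^bsub>V\<^esub> pmap V h (Idn V b) = f)"

definition transpose ::
  "('o, 'a, 'r) num_cat_scheme \<Rightarrow> 'o \<Rightarrow> 'o \<Rightarrow> 'o \<Rightarrow> 'a \<Rightarrow> 'a \<Rightarrow> 'a" where
  "transpose V z b e \<epsilon> f = (THE h. h \<in> hom V z e \<and> \<epsilon> \<odot>\<^bsub>V\<^esub> pmap V h (Idn V b) = f)"

locale num_ccc = category V
  for V :: "('o, 'a, 'r) num_cat_scheme" (structure) +
  assumes prd: "set xs \<subseteq> Obj V \<Longrightarrow> is_product V xs (Prd V xs) (Prj V xs)"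
    and exponentials: "\<lbrakk>b \<in> Obj V; c \<in> Obj V\<rbrakk> \<Longrightarrow> \<exists>e \<epsilon>. is_exponential V b c e \<epsilon>"
    and num: "is_coproduct V (replicate n (one V)) (Num V n) (Inj V n)"


section \<open>Enriched categories and functors\<close>

record ('c, 'o, 'a) ecat =
  eobj :: "'c set"
  ehom :: "'c \<Rightarrow> 'c \<Rightarrow> 'o"
  eid :: "'c \<Rightarrow> 'a"
  ecmp :: "'c \<Rightarrow> 'c \<Rightarrow> 'c \<Rightarrow> 'a"

record ('c, 'd, 'a) efun =
  fobj :: "'c \<Rightarrow> 'd"
  fhom :: "'c \<Rightarrow> 'c \<Rightarrow> 'a"

text \<open>Composition is \<open>ecmp C a b c : C(b,c) \<times> C(a,b) \<rightarrow> C(a,c)\<close>.\<close>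

locale enriched_category =
  fixes V :: "('o, 'a, 'r) num_cat_scheme" (structure)
    and C :: "('c, 'o, 'a) ecat"
  assumes ehom_obj: "\<lbrakk>a \<in> eobj C; b \<in> eobj C\<rbrakk> \<Longrightarrow> ehom C a b \<in> Obj V"
    and eid_hom: "a \<in> eobj C \<Longrightarrow> eid C a \<in> hom V (one V) (ehom C a a)"
    and ecmp_hom: "\<lbrakk>a \<in> eobj C; b \<in> eobj C; c \<in> eobj C\<rbrakk> \<Longrightarrow>
      ecmp C a b c \<in> hom V (prod2 V (ehom C b c) (ehom C a b)) (ehom C a c)"
    and ecmp_assoc: "\<lbrakk>a \<in> eobj C; b \<in> eobj C; c \<in> eobj C; d \<in> eobj C\<rbrakk> \<Longrightarrow>
      ecmp C a b d \<odot> pmap V (ecmp C b c d) (Idn V (ehom C a b)) =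
      ecmp C a c d \<odot> pmap V (Idn V (ehom C c d)) (ecmp C a b c)
        \<odot> assoc V (ehom C c d) (ehom C b c) (ehom C a b)"
    and eid_left: "\<lbrakk>a \<in> eobj C; b \<in> eobj C\<rbrakk> \<Longrightarrow>
      ecmp C a b b \<odot> pmap V (eid C b) (Idn V (ehom C a b)) = pr2 V (one V) (ehom C a b)"
    and eid_right: "\<lbrakk>a \<in> eobj C; b \<in> eobj C\<rbrakk> \<Longrightarrow>
      ecmp C a a b \<odot> pmap V (Idn V (ehom C a b)) (eid C a) = pr1 V (ehom C a b) (one V)"

locale enriched_functor =
  fixes V :: "('o, 'a, 'r) num_cat_scheme" (structure)
    and C :: "('c, 'o, 'a) ecat"
    and D :: "('d, 'o, 'a) ecat"
    and f :: "('c, 'd, 'a) efun"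
  assumes fobj_in: "a \<in> eobj C \<Longrightarrow> fobj f a \<in> eobj D"
    and fhom_hom: "\<lbrakk>a \<in> eobj C; b \<in> eobj C\<rbrakk> \<Longrightarrow>
      fhom f a b \<in> hom V (ehom C a b) (ehom D (fobj f a) (fobj f b))"
    and fhom_id: "a \<in> eobj C \<Longrightarrow> fhom f a a \<odot> eid C a = eid D (fobj f a)"
    and fhom_cmp: "\<lbrakk>a \<in> eobj C; b \<in> eobj C; c \<in> eobj C\<rbrakk> \<Longrightarrow>
      fhom f a c \<odot> ecmp C a b c =
      ecmp D (fobj f a) (fobj f b) (fobj f c) \<odot> pmap V (fhom f b c) (fhom f a b)"

definition efun_comp :: "('o, 'a, 'r) num_cat_scheme \<Rightarrow>
    ('d, 'e, 'a) efun \<Rightarrow> ('c, 'd, 'a) efun \<Rightarrow> ('c, 'e, 'a) efun" where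
  "efun_comp V g f = \<lparr>fobj = (\<lambda>a. fobj g (fobj f a)),
    fhom = (\<lambda>a b. fhom g (fobj f a) (fobj f b) \<odot>\<^bsub>V\<^esub> fhom f a b)\<rparr>"

definition eop :: "('o, 'a, 'r) num_cat_scheme \<Rightarrow> ('c, 'o, 'a) ecat \<Rightarrow> ('c, 'o, 'a) ecat" where
  "eop V C = \<lparr>eobj = eobj C, ehom = (\<lambda>a b. ehom C b a), eid = eid C,
    ecmp = (\<lambda>a b c. ecmp C c b a \<odot>\<^bsub>V\<^esub> swap V (ehom C c b) (ehom C b a))\<rparr>"


section \<open>Finite enriched products\<close>

text \<open>For \<open>p : 1 \<rightarrow> \<Prod>\<^sub>i C(b,b\<^sub>i)\<close>, the component at \<open>c\<close> of the induced transformation is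
  \<open>C(c,b) \<rightarrow> \<Prod>\<^sub>i C(b,b\<^sub>i) \<times> C(c,b) \<rightarrow> \<Prod>\<^sub>i C(c,b\<^sub>i)\<close>. A \<open>V\<close>-natural
  transformation is an isomorphism if all its components are isomorphisms in \<open>V\<close>.\<close>

definition cone_map :: "('o, 'a, 'r) num_cat_scheme \<Rightarrow> ('c, 'o, 'a) ecat \<Rightarrow>
    'c \<Rightarrow> 'c list \<Rightarrow> 'a \<Rightarrow> 'c \<Rightarrow> 'a" where
  "cone_map V C b bs p c = tuple V (ehom C c b)
    (map (\<lambda>i. ecmp C c b (bs ! i) \<odot>\<^bsub>V\<^esub>
        pair V (Prj V (map (ehom C b) bs) i \<odot>\<^bsub>V\<^esub> p \<odot>\<^bsub>V\<^esub> bang V (ehom C c b)) (Idn V (ehom C c b)))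
      [0..<length bs])"

definition universal_cone :: "('o, 'a, 'r) num_cat_scheme \<Rightarrow> ('c, 'o, 'a) ecat \<Rightarrow>
    'c \<Rightarrow> 'c list \<Rightarrow> 'a \<Rightarrow> bool" where
  "universal_cone V C b bs p \<longleftrightarrow>
    b \<in> eobj C \<and> set bs \<subseteq> eobj C \<and> p \<in> hom V (one V) (Prd V (map (ehom C b) bs)) \<and>
    (\<forall>c \<in> eobj C. is_iso V (cone_map V C b bs p c))"

definition image_cone :: "('o, 'a, 'r) num_cat_scheme \<Rightarrow> ('c, 'o, 'a) ecat \<Rightarrow>
    ('c, 'd, 'a) efun \<Rightarrow> 'c \<Rightarrow> 'c list \<Rightarrow> 'a \<Rightarrow> 'a" where
  "image_cone V C f b bs p = tuple V (one V)
    (map (\<lambda>i. fhom f b (bs ! i) \<odot>\<^bsub>V\<^esub> Prj V (map (ehom C b) bs) i \<odot>\<^bsub>V\<^esub> p) [0..<length bs])"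

definition preserves_finite_eproducts :: "('o, 'a, 'r) num_cat_scheme \<Rightarrow>
    ('c, 'o, 'a) ecat \<Rightarrow> ('d, 'o, 'a) ecat \<Rightarrow> ('c, 'd, 'a) efun \<Rightarrow> bool" where
  "preserves_finite_eproducts V C D f \<longleftrightarrow>
    (\<forall>b bs p. universal_cone V C b bs p \<longrightarrow>
      universal_cone V D (fobj f b) (map (fobj f) bs) (image_cone V C f b bs p))"


section \<open>Arity categories, theories and models\<close>

text \<open>The exponential of \<open>n\<^sub>V\<close> by \<open>m\<^sub>V\<close> is \<open>(n\<^sup>m)\<^sub>V\<close>: a number \<open>k < n ^ m\<close> codes the
  function \<open>m \<rightarrow> n\<close> whose value at \<open>i\<close> is the \<open>i\<close>-th digit of \<open>k\<close> in base \<open>n\<close>, and the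
  evaluation \<open>(n\<^sup>m)\<^sub>V \<times> m\<^sub>V \<rightarrow> n\<^sub>V\<close> is the morphism that sends the point \<open>(k, i)\<close> to this
  digit. It exists and is unique because products in a cartesian closed category distribute
  over coproducts.\<close>

definition num_ev :: "('o, 'a, 'r) num_cat_scheme \<Rightarrow> nat \<Rightarrow> nat \<Rightarrow> 'a" where
  "num_ev V m n = (THE h. h \<in> hom V (prod2 V (Num V (n ^ m)) (Num V m)) (Num V n) \<and>
    (\<forall>k < n ^ m. \<forall>i < m.
      h \<odot>\<^bsub>V\<^esub> pair V (Inj V (n ^ m) k) (Inj V m i) = Inj V n (k div n ^ i mod n)))"

text \<open>The full sub-\<open>V\<close>-category of \<open>V\<close> on the objects \<open>n\<^sub>V\<close>. Its objects are the numbers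
  \<open>n\<close> themselves, since \<open>n\<^sub>V\<close> need not determine \<open>n\<close> (for instance if \<open>V\<close> is a preorder).\<close>

definition num_ecat :: "('o, 'a, 'r) num_cat_scheme \<Rightarrow> (nat, 'o, 'a) ecat" where
  "num_ecat V = \<lparr>eobj = UNIV,
    ehom = (\<lambda>m n. Num V (n ^ m)),
    eid = (\<lambda>m. transpose V (one V) (Num V m) (Num V (m ^ m)) (num_ev V m m)
      (pr2 V (one V) (Num V m))),
    ecmp = (\<lambda>l m n.
      transpose V (prod2 V (Num V (n ^ m)) (Num V (m ^ l))) (Num V l) (Num V (n ^ l))
        (num_ev V l n)
        (num_ev V m n \<odot>\<^bsub>V\<^esub> pmap V (Idn V (Num V (n ^ m))) (num_ev V l m)
          \<odot>\<^bsub>V\<^esub> assoc V (Num V (n ^ m)) (Num V (m ^ l)) (Num V l)))\<rparr>"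

definition arity_ecat :: "('o, 'a, 'r) num_cat_scheme \<Rightarrow> (nat, 'o, 'a) ecat" where
  "arity_ecat V = eop V (num_ecat V)"

definition enriched_theory :: "('o, 'a, 'r) num_cat_scheme \<Rightarrow>
    (nat, 'o, 'a) ecat \<Rightarrow> (nat, nat, 'a) efun \<Rightarrow> bool" where
  "enriched_theory V T \<tau> \<longleftrightarrow>
    enriched_category V T \<and> enriched_functor V (arity_ecat V) T \<tau> \<and>
    eobj T = eobj (arity_ecat V) \<and> (\<forall>n \<in> eobj (arity_ecat V). fobj \<tau> n = n) \<and>
    preserves_finite_eproducts V (arity_ecat V) T \<tau>"

definition is_model :: "('o, 'a, 'r) num_cat_scheme \<Rightarrow> (nat, 'o, 'a) ecat \<Rightarrow>
    (nat, nat, 'a) efun \<Rightarrow> ('c, 'o, 'a) ecat \<Rightarrow> (nat, 'c, 'a) efun \<Rightarrow> bool" where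
  "is_model V T \<tau> C \<mu> \<longleftrightarrow>
    enriched_theory V T \<tau> \<and> enriched_category V C \<and> enriched_functor V T C \<mu> \<and>
    preserves_finite_eproducts V T C \<mu>"


section \<open>Cartesian functors and change of base\<close>

record ('o, 'a, 'p, 'b) func =
  ob :: "'o \<Rightarrow> 'p"
  ar :: "'a \<Rightarrow> 'b"

locale cat_functor =
  fixes C :: "('o, 'a, 'r) cat_scheme"
    and D :: "('p, 'b, 's) cat_scheme"
    and F :: "('o, 'a, 'p, 'b) func"
  assumes ob_in: "x \<in> Obj C \<Longrightarrow> ob F x \<in> Obj D"
    and ar_hom: "f \<in> hom C x y \<Longrightarrow> ar F f \<in> hom D (ob F x) (ob F y)"
    and ar_idn: "x \<in> Obj C \<Longrightarrow> ar F (Idn C x) = Idn D (ob F x)"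
    and ar_cmp: "\<lbrakk>f \<in> hom C x y; g \<in> hom C y z\<rbrakk> \<Longrightarrow>
      ar F (g \<odot>\<^bsub>C\<^esub> f) = ar F g \<odot>\<^bsub>D\<^esub> ar F f"

definition cartesian_functor :: "('o, 'a, 'r) cat_scheme \<Rightarrow> ('p, 'b, 's) cat_scheme \<Rightarrow>
    ('o, 'a, 'p, 'b) func \<Rightarrow> bool" where
  "cartesian_functor C D F \<longleftrightarrow> cat_functor C D F \<and>
    (\<forall>xs p \<pi>. set xs \<subseteq> Obj C \<and> is_product C xs p \<pi> \<longrightarrow>
      is_product D (map (ob F) xs) (ob F p) (\<lambda>i. ar F (\<pi> i)))"

text \<open>The canonical morphism \<open>\<Prod>\<^sub>i F(x\<^sub>i) \<rightarrow> F(\<Prod>\<^sub>i x\<^sub>i)\<close>, which is an isomorphism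
  for cartesian \<open>F\<close>.\<close>

definition prd_comparison :: "('o, 'a, 'r) num_cat_scheme \<Rightarrow> ('p, 'b, 's) num_cat_scheme \<Rightarrow>
    ('o, 'a, 'p, 'b) func \<Rightarrow> 'o list \<Rightarrow> 'b" where
  "prd_comparison V W F xs = (THE h. h \<in> hom W (Prd W (map (ob F) xs)) (ob F (Prd V xs)) \<and>
    (\<forall>i < length xs. ar F (Prj V xs i) \<odot>\<^bsub>W\<^esub> h = Prj W (map (ob F) xs) i))"

text \<open>Preservation of the chosen coproducts is preservation of the coproduct cocones: besides
  \<open>F(n\<^sub>V) = n\<^sub>W\<close>, the coprojections correspond under \<open>1\<^sub>W \<cong> F(1\<^sub>V)\<close>. Equality of objects
  alone would still allow \<open>F\<close> to permute the \<open>n\<close> summands of \<open>n\<^sub>W\<close>, and identities on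
  hom-objects would then not be compatible with composition in the arity categories.\<close>

definition preserves_num :: "('o, 'a, 'r) num_cat_scheme \<Rightarrow> ('p, 'b, 's) num_cat_scheme \<Rightarrow>
    ('o, 'a, 'p, 'b) func \<Rightarrow> bool" where
  "preserves_num V W F \<longleftrightarrow> (\<forall>n. ob F (Num V n) = Num W n \<and>
    (\<forall>i < n. ar F (Inj V n i) \<odot>\<^bsub>W\<^esub> prd_comparison V W F [] = Inj W n i))"

definition base_change :: "('o, 'a, 'r) num_cat_scheme \<Rightarrow> ('p, 'b, 's) num_cat_scheme \<Rightarrow>
    ('o, 'a, 'p, 'b) func \<Rightarrow> ('c, 'o, 'a) ecat \<Rightarrow> ('c, 'p, 'b) ecat" where
  "base_change V W F C = \<lparr>eobj = eobj C,
    ehom = (\<lambda>a b. ob F (ehom C a b)),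
    eid = (\<lambda>a. ar F (eid C a) \<odot>\<^bsub>W\<^esub> prd_comparison V W F []),
    ecmp = (\<lambda>a b c. ar F (ecmp C a b c) \<odot>\<^bsub>W\<^esub> prd_comparison V W F [ehom C b c, ehom C a b])\<rparr>"

definition base_change_fun ::
    "('o, 'a, 'p, 'b) func \<Rightarrow> ('c, 'd, 'a) efun \<Rightarrow> ('c, 'd, 'b) efun" where
  "base_change_fun F f = \<lparr>fobj = fobj f, fhom = (\<lambda>a b. ar F (fhom f a b))\<rparr>"

text \<open>\<open>F\<^sup>~ : A\<^sub>W \<rightarrow> F\<^sub>*(A\<^sub>V)\<close> is the identity of \<open>(m\<^sup>n)\<^sub>W = F((m\<^sup>n)\<^sub>V)\<close> on the hom-object
  from \<open>m\<close> to \<open>n\<close>.\<close>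

definition arity_iso :: "('p, 'b, 's) num_cat_scheme \<Rightarrow> (nat, nat, 'b) efun" where
  "arity_iso W = \<lparr>fobj = (\<lambda>n. n), fhom = (\<lambda>m n. Idn W (ehom (arity_ecat W) m n))\<rparr>"

definition base_change_theory :: "('p, 'b, 's) num_cat_scheme \<Rightarrow>
    ('o, 'a, 'p, 'b) func \<Rightarrow> (nat, nat, 'a) efun \<Rightarrow> (nat, nat, 'b) efun" where
  "base_change_theory W F \<tau> = efun_comp W (base_change_fun F \<tau>) (arity_iso W)"

end

theory Submission
  imports Defs
begin

text \<open>A cone in an enriched category is universal iff, for every object \<open>c\<close>, certain maps exhibit
  \<open>C(c,b)\<close> as a product of the \<open>C(c,b\<^sub>i)\<close>, so a cartesian \<open>F\<close> sends universal cones of \<open>C\<close> to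
  universal cones of \<open>F\<^sub>*(C)\<close>. Not every cone of \<open>F\<^sub>*(C)\<close> arises in this way, but enriched
  products are unique up to isomorphism: if \<open>C\<close> has finite products, it suffices that a functor on
  \<open>F\<^sub>*(C)\<close> preserves one universal cone for each family. The arity category has finite products,
  because \<open>(n\<^sup>m)\<^sub>V\<close> is the \<open>m\<close>-th power of \<open>n\<^sub>V\<close>, and hence so does every theory. Finally
  \<open>F\<^sub>*(A\<^sub>V) = A\<^sub>W\<close> on the nose, since maps between the objects \<open>n\<^sub>V\<close> and their products are
  determined by their values on the coprojections.\<close>

section \<open>Categories with finite products\<close>

text \<open>Rewriting \<open>1\<close> to \<open>Suc 0\<close> would keep the rules for \<open>pr2 V x y = Prj V [x, y] 1\<close> from matching.\<close>

declare One_nat_def [simp del]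
declare hom_def [simp]

text \<open>The legs of a cone in \<open>F_*(C)\<close> are points of objects
  \<open>F(C(b,b_i))\<close>, and such points need not be images of points in V. They are reached
  only by comparison: two universal cones on one family differ by mutually inverse points, and every
  enriched functor keeps these inverse.

  Diagrams would fill up with the comparison maps of \<open>F\<close>, so they are replaced by
  equations between elements \<open>z -> C(a,b)\<close> at arbitrary stages \<open>z\<close>.
  Elements of \<open>F_*(C)\<close> at a common stage are restrictions, along one morphism, of
  images of projections in V; hence an equation between projections in V gives one in W.

  The terminal object need not separate the morphisms of V. Morphisms out of \<open>m_V\<close> and
  \<open>z * m_V\<close> can nevertheless be compared on coprojections, since cartesian closure
  makes \<open>z * -\<close> preserve coproducts. On points \<open>num_ev\<close> extracts digits,
  and composition of arities becomes composition of functions.\<close>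

lemma ex1_unique: "\<lbrakk>\<exists>!x. P x; P a; P b\<rbrakk> \<Longrightarrow> a = b"
  by blast

section \<open>Products and isomorphisms in an arbitrary category\<close>

context category begin

lemma cmp_arr [simp]:
  assumes "f \<in> Arr C" "g \<in> Arr C" "Src C g = Tgt C f"
  shows "g \<odot> f \<in> Arr C" "Src C (g \<odot> f) = Src C f" "Tgt C (g \<odot> f) = Tgt C g"
  using assms cmp_hom [of f "Src C f" "Tgt C f" g "Tgt C g"] by auto

lemma idn_arr [simp]:
  assumes "x \<in> Obj C"
  shows "Idn C x \<in> Arr C" "Src C (Idn C x) = x" "Tgt C (Idn C x) = x"
  using assms idn_hom [of x] by auto

lemma cmp_idn [simp]:
  "\<lbrakk>f \<in> Arr C; Tgt C f = x\<rbrakk> \<Longrightarrow> Idn C x \<odot> f = f"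
  "\<lbrakk>f \<in> Arr C; Src C f = x\<rbrakk> \<Longrightarrow> f \<odot> Idn C x = f"
  using idn_left [of f "Src C f" x] idn_right [of f x "Tgt C f"] by auto

lemma assoc_simp [simp]:
  "\<lbrakk>f \<in> Arr C; g \<in> Arr C; h \<in> Arr C; Src C g = Tgt C f; Src C h = Tgt C g\<rbrakk>
    \<Longrightarrow> (h \<odot> g) \<odot> f = h \<odot> (g \<odot> f)"
  using cmp_assoc [of f "Src C f" "Tgt C f" g "Tgt C g" h "Tgt C h"] by auto

lemma src_tgt_obj [simp]: "f \<in> Arr C \<Longrightarrow> Src C f \<in> Obj C" "f \<in> Arr C \<Longrightarrow> Tgt C f \<in> Obj C"
  by (auto intro: src_in tgt_in)

lemma is_productD:
  assumes "is_product C xs p \<pi>"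
  shows "p \<in> Obj C" "i < length xs \<Longrightarrow> \<pi> i \<in> hom C p (xs ! i)"
  using assms unfolding is_product_def by blast+

lemma is_product_ex1:
  assumes "is_product C xs p \<pi>" "z \<in> Obj C" "\<forall>i < length xs. f i \<in> hom C z (xs ! i)"
  shows "\<exists>!h. h \<in> hom C z p \<and> (\<forall>i < length xs. \<pi> i \<odot> h = f i)"
  using assms(1) [unfolded is_product_def, THEN conjunct2, THEN conjunct2] assms(2,3)
  by (elim ballE [of _ _ z] allE [of _ f] impE) auto

lemma is_product_ext:
  assumes "is_product C xs p \<pi>" "h \<in> hom C z p" "h' \<in> hom C z p"
    and "\<And>i. i < length xs \<Longrightarrow> \<pi> i \<odot> h = \<pi> i \<odot> h'"
  shows "h = h'"
proof -
  have "z \<in> Obj C" using assms(2) by auto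
  moreover have "\<forall>i < length xs. \<pi> i \<odot> h \<in> hom C z (xs ! i)"
    using is_productD [OF assms(1)] assms(2) by simp
  ultimately have "\<exists>!k. k \<in> hom C z p \<and> (\<forall>i < length xs. \<pi> i \<odot> k = \<pi> i \<odot> h)"
    by (rule is_product_ex1 [OF assms(1)])
  then show ?thesis
  proof (rule ex1_unique)
    show "h \<in> hom C z p \<and> (\<forall>i < length xs. \<pi> i \<odot> h = \<pi> i \<odot> h)" using assms(2) by blast
    show "h' \<in> hom C z p \<and> (\<forall>i < length xs. \<pi> i \<odot> h' = \<pi> i \<odot> h)" using assms(3,4) by simp
  qed
qed

lemma is_productI:
  assumes "p \<in> Obj C" "\<And>i. i < length xs \<Longrightarrow> \<pi> i \<in> hom C p (xs ! i)"
    and "\<And>z f. \<lbrakk>z \<in> Obj C; \<And>i. i < length xs \<Longrightarrow> f i \<in> hom C z (xs ! i)\<rbrakk>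
      \<Longrightarrow> \<exists>h \<in> hom C z p. \<forall>i < length xs. \<pi> i \<odot> h = f i"
    and "\<And>z h h'. \<lbrakk>z \<in> Obj C; h \<in> hom C z p; h' \<in> hom C z p;
        \<And>i. i < length xs \<Longrightarrow> \<pi> i \<odot> h = \<pi> i \<odot> h'\<rbrakk> \<Longrightarrow> h = h'"
  shows "is_product C xs p \<pi>"
  unfolding is_product_def
proof (intro conjI ballI allI impI)
  fix z f assume z: "z \<in> Obj C" and "\<forall>i < length xs. f i \<in> hom C z (xs ! i)"
  then obtain h where "h \<in> hom C z p" "\<forall>i < length xs. \<pi> i \<odot> h = f i" using assms(3) by blast
  then show "\<exists>!h. h \<in> hom C z p \<and> (\<forall>i < length xs. \<pi> i \<odot> h = f i)"
    using assms(4) [OF z] by metis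
qed (use assms in auto)

lemma is_product_exists:
  assumes "is_product C xs p \<pi>" "z \<in> Obj C" "\<And>i. i < length xs \<Longrightarrow> f i \<in> hom C z (xs ! i)"
  shows "\<exists>h \<in> hom C z p. \<forall>i < length xs. \<pi> i \<odot> h = f i"
  using is_product_ex1 [of xs p \<pi> z f] assms by blast

lemma is_product_cong:
  assumes "\<And>i. i < length xs \<Longrightarrow> \<pi> i = \<pi>' i"
  shows "is_product C xs p \<pi> \<longleftrightarrow> is_product C xs p \<pi>'"
  using assms unfolding is_product_def by (simp cong: conj_cong)

text \<open>Two objects represent the same families exactly if the comparison between them is
  invertible. This trades a map into a chosen product, which \<open>F\<close> need not carry to a
  chosen product, for a product cone, which \<open>F\<close> preserves as it stands.\<close>

lemma is_iso_iff_is_product: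
  assumes P: "is_product C xs p \<pi>" and t: "t \<in> hom C q p"
    and l: "\<And>i. i < length xs \<Longrightarrow> \<pi> i \<odot> t = l i"
  shows "is_iso C t \<longleftrightarrow> is_product C xs q l"
proof
  have \<pi>: "\<And>i. i < length xs \<Longrightarrow> \<pi> i \<in> hom C p (xs ! i)" "p \<in> Obj C" and q: "q \<in> Obj C"
    using is_productD [OF P] t by auto
  have lh: "\<And>i. i < length xs \<Longrightarrow> l i \<in> hom C q (xs ! i)" using \<pi> t l [symmetric] by auto
  {
    assume "is_iso C t"
    then obtain g where g: "g \<in> hom C p q" "g \<odot> t = Idn C q" "t \<odot> g = Idn C p"
      using t by (auto simp: is_iso_def)
    have ext: "h = h'" if "h \<in> hom C z q" "h' \<in> hom C z q"
      "\<And>i. i < length xs \<Longrightarrow> l i \<odot> h = l i \<odot> h'" for h h' z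
    proof -
      have "t \<odot> h = t \<odot> h'"
      proof (rule is_product_ext [OF P])
        fix i assume i: "i < length xs"
        show "\<pi> i \<odot> t \<odot> h = \<pi> i \<odot> t \<odot> h'"
          using that(1,2) that(3) [OF i] \<pi>(1) [OF i] t l [OF i, symmetric] by simp
      qed (use that t in auto)
      then have "(g \<odot> t) \<odot> h = (g \<odot> t) \<odot> h'" using that(1,2) g(1) t by simp
      then show ?thesis using that(1,2) g(2) by simp
    qed
    show "is_product C xs q l"
    proof (rule is_productI)
      fix z f assume z: "z \<in> Obj C" and f: "\<And>i. i < length xs \<Longrightarrow> f i \<in> hom C z (xs ! i)"
      obtain h where h: "h \<in> hom C z p" "\<And>i. i < length xs \<Longrightarrow> \<pi> i \<odot> h = f i"
        using is_product_exists [OF P z f] by blast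
      have "l i \<odot> g \<odot> h = f i" if i: "i < length xs" for i
      proof -
        have "l i \<odot> g \<odot> h = \<pi> i \<odot> (t \<odot> g) \<odot> h"
          using \<pi>(1) [OF i] t g(1) h(1) l [OF i, symmetric] by simp
        then show ?thesis using g(3) h i by simp
      qed
      moreover have "g \<odot> h \<in> hom C z q" using g h by auto
      ultimately show "\<exists>h \<in> hom C z q. \<forall>i < length xs. l i \<odot> h = f i" by blast
    qed (use q lh ext in blast)+
  next
    assume Q: "is_product C xs q l"
    obtain g where g: "g \<in> hom C p q" "\<And>i. i < length xs \<Longrightarrow> l i \<odot> g = \<pi> i"
      using is_product_exists [OF Q \<pi>(2) \<pi>(1)] by blast
    have "g \<odot> t = Idn C q"
    proof (rule is_product_ext [OF Q])
      fix i assume i: "i < length xs"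
      have "l i \<odot> g \<odot> t = (l i \<odot> g) \<odot> t" using lh [OF i] g(1) t by simp
      then show "l i \<odot> g \<odot> t = l i \<odot> Idn C q" using g(2) [OF i] l [OF i] lh [OF i] by simp
    qed (use g t q in auto)
    moreover have "t \<odot> g = Idn C p"
    proof (rule is_product_ext [OF P])
      fix i assume i: "i < length xs"
      have "\<pi> i \<odot> t \<odot> g = (\<pi> i \<odot> t) \<odot> g" using \<pi>(1) [OF i] g(1) t by simp
      then show "\<pi> i \<odot> t \<odot> g = \<pi> i \<odot> Idn C p" using g(2) [OF i] l [OF i] \<pi>(1) [OF i] by simp
    qed (use g t \<pi> in auto)
    ultimately show "is_iso C t" using g t by (auto simp: is_iso_def)
  }
qed

end

section \<open>Equational calculus of chosen products\<close>

context num_ccc begin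

lemma prd_obj [simp]: "set xs \<subseteq> Obj V \<Longrightarrow> Prd V xs \<in> Obj V"
  using prd is_productD by blast

lemma prj_arr [simp]:
  assumes "set xs \<subseteq> Obj V" "i < length xs"
  shows "Prj V xs i \<in> Arr V" "Src V (Prj V xs i) = Prd V xs" "Tgt V (Prj V xs i) = xs ! i"
  using is_productD(2) [OF prd [OF assms(1)] assms(2)] by auto

lemma tuple_props:
  assumes z: "z \<in> Obj V" and fs: "\<And>f. f \<in> set fs \<Longrightarrow> f \<in> Arr V \<and> Src V f = z"
  shows "tuple V z fs \<in> hom V z (Prd V (map (Tgt V) fs)) \<and>
    (\<forall>i < length fs. Prj V (map (Tgt V) fs) i \<odot> tuple V z fs = fs ! i)"
proof -
  have "set (map (Tgt V) fs) \<subseteq> Obj V" using fs by auto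
  from is_product_ex1 [OF prd [OF this] z, of "(!) fs"] have
    "\<exists>!h. h \<in> hom V z (Prd V (map (Tgt V) fs)) \<and>
      (\<forall>i < length fs. Prj V (map (Tgt V) fs) i \<odot> h = fs ! i)"
    using fs by simp
  then show ?thesis unfolding tuple_def by (rule theI')
qed

lemma bang_arr [simp]:
  assumes "z \<in> Obj V"
  shows "bang V z \<in> Arr V" "Src V (bang V z) = z" "Tgt V (bang V z) = one V"
  using tuple_props [OF assms, of "[]"] by (auto simp: bang_def)

lemma one_ext:
  assumes "f \<in> Arr V" "g \<in> Arr V" "Src V f = Src V g" "Tgt V f = one V" "Tgt V g = one V"
  shows "f = g"
  by (rule is_product_ext [OF prd [of "[]"]]) (use assms in auto)

lemma bang_cmp [simp]:
  assumes "f \<in> Arr V" "Tgt V f = z"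
  shows "bang V z \<odot> f = bang V (Src V f)"
  by (rule one_ext) (use assms in auto)

lemma bang_one [simp]: "bang V (one V) = Idn V (one V)"
  by (rule one_ext) auto

lemma all_less_two: "(\<forall>i < length [x, y]. P i) \<longleftrightarrow> P 0 \<and> P 1"
  by (auto simp: less_Suc_eq One_nat_def)

lemma pair_props:
  assumes "f \<in> Arr V" "g \<in> Arr V" "Src V f = Src V g"
  shows "pair V f g \<in> hom V (Src V f) (prod2 V (Tgt V f) (Tgt V g)) \<and>
    pr1 V (Tgt V f) (Tgt V g) \<odot> pair V f g = f \<and>
    pr2 V (Tgt V f) (Tgt V g) \<odot> pair V f g = g"
proof -
  have "tuple V (Src V f) [f, g] \<in> hom V (Src V f) (Prd V (map (Tgt V) [f, g])) \<and>
    (\<forall>i < length [f, g]. Prj V (map (Tgt V) [f, g]) i \<odot> tuple V (Src V f) [f, g] = [f, g] ! i)"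
    by (rule tuple_props) (use assms in auto)
  then show ?thesis unfolding all_less_two pair_def by simp
qed

lemma pair_arr [simp]:
  assumes "f \<in> Arr V" "g \<in> Arr V" "Src V f = Src V g"
  shows "pair V f g \<in> Arr V" "Src V (pair V f g) = Src V f"
    "Tgt V (pair V f g) = prod2 V (Tgt V f) (Tgt V g)"
  using pair_props [OF assms] by auto

lemma pr_arr [simp]:
  assumes "x \<in> Obj V" "y \<in> Obj V"
  shows "pr1 V x y \<in> Arr V" "Src V (pr1 V x y) = prod2 V x y" "Tgt V (pr1 V x y) = x"
    "pr2 V x y \<in> Arr V" "Src V (pr2 V x y) = prod2 V x y" "Tgt V (pr2 V x y) = y"
  using assms by auto

lemma pr_pair [simp]:
  assumes "f \<in> Arr V" "g \<in> Arr V" "Src V f = Src V g" "Tgt V f = x" "Tgt V g = y"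
  shows "pr1 V x y \<odot> pair V f g = f" "pr2 V x y \<odot> pair V f g = g"
  using pair_props [of f g] assms by auto

lemma pair_ext:
  assumes "h \<in> hom V z (prod2 V x y)" "h' \<in> hom V z (prod2 V x y)" "x \<in> Obj V" "y \<in> Obj V"
    and "pr1 V x y \<odot> h = pr1 V x y \<odot> h'" "pr2 V x y \<odot> h = pr2 V x y \<odot> h'"
  shows "h = h'"
proof (rule is_product_ext [OF prd [of "[x, y]"]])
  show "Prj V [x, y] i \<odot> h = Prj V [x, y] i \<odot> h'" if "i < length [x, y]" for i
    using assms(5,6) that all_less_two [of x y "\<lambda>i. Prj V [x, y] i \<odot> h = Prj V [x, y] i \<odot> h'"] by blast
qed (use assms in auto)

lemma pr_pair_cmp [simp]:
  assumes "f \<in> Arr V" "g \<in> Arr V" "h \<in> Arr V" "Src V f = Src V g" "Tgt V f = x" "Tgt V g = y"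
    "Tgt V h = Src V g"
  shows "pr1 V x y \<odot> pair V f g \<odot> h = f \<odot> h" "pr2 V x y \<odot> pair V f g \<odot> h = g \<odot> h"
proof -
  have "pr1 V x y \<odot> pair V f g \<odot> h = (pr1 V x y \<odot> pair V f g) \<odot> h"
    "pr2 V x y \<odot> pair V f g \<odot> h = (pr2 V x y \<odot> pair V f g) \<odot> h"
    by (rule assoc_simp [symmetric]; use assms in auto)+
  then show "pr1 V x y \<odot> pair V f g \<odot> h = f \<odot> h" "pr2 V x y \<odot> pair V f g \<odot> h = g \<odot> h"
    using assms by (simp_all del: assoc_simp)
qed

lemma pair_cmp [simp]:
  assumes "f \<in> Arr V" "g \<in> Arr V" "h \<in> Arr V" "Src V f = Src V g" "Tgt V h = Src V g"
  shows "pair V f g \<odot> h = pair V (f \<odot> h) (g \<odot> h)"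
  by (rule pair_ext [of _ "Src V h" "Tgt V f" "Tgt V g"]) (use assms in auto)

lemma pair_pr [simp]:
  assumes "x \<in> Obj V" "y \<in> Obj V"
  shows "pair V (pr1 V x y) (pr2 V x y) = Idn V (prod2 V x y)"
  by (rule pair_ext [of _ "prod2 V x y" x y]) (use assms in auto)

lemma pair_pr_cmp [simp]:
  assumes "f \<in> Arr V" "Tgt V f = prod2 V x y" "x \<in> Obj V" "y \<in> Obj V"
  shows "pair V (pr1 V x y \<odot> f) (pr2 V x y \<odot> f) = f"
  by (rule pair_ext [of _ "Src V f" x y]) (use assms in auto)

end

section \<open>Generalized elements of hom-objects\<close>

text \<open>Composition of generalized elements \<open>g : z \<rightarrow> C(b,c)\<close> and \<open>f : z \<rightarrow> C(a,b)\<close>.\<close>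

definition gcmp :: "('o, 'a, 'r) num_cat_scheme \<Rightarrow> ('c, 'o, 'a) ecat \<Rightarrow>
    'c \<Rightarrow> 'c \<Rightarrow> 'c \<Rightarrow> 'a \<Rightarrow> 'a \<Rightarrow> 'a" where
  "gcmp V C a b c g f = ecmp C a b c \<odot>\<^bsub>V\<^esub> pair V g f"

context num_ccc begin

text \<open>Each diagram is the elementwise law at its universal elements, the projections out of
  the source of the diagram (Yoneda).\<close>

lemma enriched_categoryI:
  assumes obj: "\<And>a b. \<lbrakk>a \<in> eobj C; b \<in> eobj C\<rbrakk> \<Longrightarrow> ehom C a b \<in> Obj V"
    and eid: "\<And>a. a \<in> eobj C \<Longrightarrow> eid C a \<in> hom V (one V) (ehom C a a)"
    and ecmp: "\<And>a b c. \<lbrakk>a \<in> eobj C; b \<in> eobj C; c \<in> eobj C\<rbrakk> \<Longrightarrow>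
      ecmp C a b c \<in> hom V (prod2 V (ehom C b c) (ehom C a b)) (ehom C a c)"
    and assoc: "\<And>a b c d z f g h. \<lbrakk>a \<in> eobj C; b \<in> eobj C; c \<in> eobj C; d \<in> eobj C;
        z \<in> Obj V; f \<in> hom V z (ehom C a b); g \<in> hom V z (ehom C b c); h \<in> hom V z (ehom C c d)\<rbrakk>
      \<Longrightarrow> gcmp V C a b d (gcmp V C b c d h g) f = gcmp V C a c d h (gcmp V C a b c g f)"
    and left: "\<And>a b z f. \<lbrakk>a \<in> eobj C; b \<in> eobj C; z \<in> Obj V; f \<in> hom V z (ehom C a b)\<rbrakk>
      \<Longrightarrow> gcmp V C a b b (eid C b \<odot> bang V z) f = f"
    and right: "\<And>a b z f. \<lbrakk>a \<in> eobj C; b \<in> eobj C; z \<in> Obj V; f \<in> hom V z (ehom C a b)\<rbrakk>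
      \<Longrightarrow> gcmp V C a a b f (eid C a \<odot> bang V z) = f"
  shows "enriched_category V C"
proof
  note [simp] = obj eid [simplified] ecmp [simplified]
  fix a b c d assume [simp]: "a \<in> eobj C" "b \<in> eobj C" "c \<in> eobj C" "d \<in> eobj C"
  let ?x = "ehom C c d" let ?y = "ehom C b c" let ?z = "ehom C a b"
  let ?p = "pr1 V (prod2 V ?x ?y) ?z"
  show "ecmp C a b d \<odot> pmap V (ecmp C b c d) (Idn V ?z) =
      ecmp C a c d \<odot> pmap V (Idn V ?x) (ecmp C a b c) \<odot> assoc V ?x ?y ?z"
    using assoc [of a b c d "prod2 V (prod2 V ?x ?y) ?z" "pr2 V (prod2 V ?x ?y) ?z"
        "pr2 V ?x ?y \<odot> ?p" "pr1 V ?x ?y \<odot> ?p"]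
    by (simp add: gcmp_def pmap_def assoc_def)
  have "bang V (prod2 V (one V) ?z) = pr1 V (one V) ?z" by (rule one_ext) simp_all
  then show "ecmp C a b b \<odot> pmap V (eid C b) (Idn V ?z) = pr2 V (one V) ?z"
    using left [of a b "prod2 V (one V) ?z" "pr2 V (one V) ?z"]
    by (simp add: gcmp_def pmap_def)
  have "bang V (prod2 V ?z (one V)) = pr2 V ?z (one V)" by (rule one_ext) simp_all
  then show "ecmp C a a b \<odot> pmap V (Idn V ?z) (eid C a) = pr1 V ?z (one V)"
    using right [of a b "prod2 V ?z (one V)" "pr1 V ?z (one V)"]
    by (simp add: gcmp_def pmap_def)
qed (use obj eid ecmp in blast)+

end

locale enriched_over_ccc = num_ccc V + enriched_category V C
  for V :: "('o, 'a, 'r) num_cat_scheme" (structure) and C :: "('c, 'o, 'a) ecat"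
begin

lemma ehom_arr [simp]:
  "\<lbrakk>a \<in> eobj C; b \<in> eobj C\<rbrakk> \<Longrightarrow> ehom C a b \<in> Obj V"
  "a \<in> eobj C \<Longrightarrow> eid C a \<in> Arr V"
  "a \<in> eobj C \<Longrightarrow> Src V (eid C a) = one V"
  "a \<in> eobj C \<Longrightarrow> Tgt V (eid C a) = ehom C a a"
  "\<lbrakk>a \<in> eobj C; b \<in> eobj C; c \<in> eobj C\<rbrakk> \<Longrightarrow> ecmp C a b c \<in> Arr V"
  "\<lbrakk>a \<in> eobj C; b \<in> eobj C; c \<in> eobj C\<rbrakk> \<Longrightarrow>
    Src V (ecmp C a b c) = prod2 V (ehom C b c) (ehom C a b)"
  "\<lbrakk>a \<in> eobj C; b \<in> eobj C; c \<in> eobj C\<rbrakk> \<Longrightarrow> Tgt V (ecmp C a b c) = ehom C a c"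
  using ehom_obj eid_hom ecmp_hom by auto

lemma gcmp_arr [simp]:
  assumes "a \<in> eobj C" "b \<in> eobj C" "c \<in> eobj C" "f \<in> Arr V" "g \<in> Arr V"
    "Src V g = Src V f" "Tgt V f = ehom C a b" "Tgt V g = ehom C b c"
  shows "gcmp V C a b c g f \<in> Arr V" "Src V (gcmp V C a b c g f) = Src V f"
    "Tgt V (gcmp V C a b c g f) = ehom C a c"
  using assms by (auto simp: gcmp_def)

lemma gcmp_cmp [simp]:
  assumes "a \<in> eobj C" "b \<in> eobj C" "c \<in> eobj C" "f \<in> Arr V" "g \<in> Arr V" "t \<in> Arr V"
    "Src V g = Src V f" "Tgt V f = ehom C a b" "Tgt V g = ehom C b c" "Tgt V t = Src V f"
  shows "gcmp V C a b c g f \<odot> t = gcmp V C a b c (g \<odot> t) (f \<odot> t)"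
  using assms by (auto simp: gcmp_def)

text \<open>The passage back from diagrams to elements: the axiom is precomposed with the tuple of
  the three given elements.\<close>

lemma gcmp_assoc:
  assumes "a \<in> eobj C" "b \<in> eobj C" "c \<in> eobj C" "d \<in> eobj C"
    "f \<in> hom V z (ehom C a b)" "g \<in> hom V z (ehom C b c)" "h \<in> hom V z (ehom C c d)"
  shows "gcmp V C a b d (gcmp V C b c d h g) f = gcmp V C a c d h (gcmp V C a b c g f)"
proof -
  let ?x = "ehom C c d" let ?y = "ehom C b c" let ?z = "ehom C a b"
  let ?t = "pair V (pair V h g) f"
  have "ecmp C a b d \<odot> pmap V (ecmp C b c d) (Idn V ?z) \<odot> ?t =
      (ecmp C a b d \<odot> pmap V (ecmp C b c d) (Idn V ?z)) \<odot> ?t"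
    by (rule assoc_simp [symmetric]; use assms in \<open>simp add: pmap_def\<close>)
  also have "\<dots> = (ecmp C a c d \<odot> pmap V (Idn V ?x) (ecmp C a b c) \<odot> assoc V ?x ?y ?z) \<odot> ?t"
    using ecmp_assoc [of a b c d] assms by simp
  finally show ?thesis using assms by (simp add: pmap_def assoc_def gcmp_def)
qed

lemma gcmp_eid_left [simp]:
  assumes "a \<in> eobj C" "b \<in> eobj C" "f \<in> Arr V" "Tgt V f = ehom C a b" "Src V f = z"
  shows "gcmp V C a b b (eid C b \<odot> bang V z) f = f"
proof -
  let ?z = "ehom C a b" let ?t = "pair V (bang V z) f"
  have "ecmp C a b b \<odot> pmap V (eid C b) (Idn V ?z) \<odot> ?t =
      (ecmp C a b b \<odot> pmap V (eid C b) (Idn V ?z)) \<odot> ?t"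
    by (rule assoc_simp [symmetric]; use assms in \<open>force simp: pmap_def\<close>)
  also have "\<dots> = pr2 V (one V) ?z \<odot> ?t"
    using eid_left [of a b] assms by simp
  finally show ?thesis using assms by (auto simp: pmap_def gcmp_def)
qed

lemma gcmp_eid_right [simp]:
  assumes "a \<in> eobj C" "b \<in> eobj C" "f \<in> Arr V" "Tgt V f = ehom C a b" "Src V f = z"
  shows "gcmp V C a a b f (eid C a \<odot> bang V z) = f"
proof -
  let ?z = "ehom C a b" let ?t = "pair V f (bang V z)"
  have "ecmp C a a b \<odot> pmap V (Idn V ?z) (eid C a) \<odot> ?t =
      (ecmp C a a b \<odot> pmap V (Idn V ?z) (eid C a)) \<odot> ?t"
    by (rule assoc_simp [symmetric]; use assms in \<open>force simp: pmap_def\<close>)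
  also have "\<dots> = pr1 V ?z (one V) \<odot> ?t"
    using eid_right [of a b] assms by simp
  finally show ?thesis using assms by (auto simp: pmap_def gcmp_def)
qed

end

text \<open>Universality of the cone with legs \<open>q i : 1 \<rightarrow> C(b, bs ! i)\<close>, stated in terms of
  products in \<open>V\<close> so that cartesian functors visibly preserve it.\<close>

definition is_eproduct :: "('o, 'a, 'r) num_cat_scheme \<Rightarrow> ('c, 'o, 'a) ecat \<Rightarrow>
    'c \<Rightarrow> 'c list \<Rightarrow> (nat \<Rightarrow> 'a) \<Rightarrow> bool" where
  "is_eproduct V C b bs q \<longleftrightarrow> b \<in> eobj C \<and> set bs \<subseteq> eobj C \<and>
    (\<forall>i < length bs. q i \<in> hom V (one V) (ehom C b (bs ! i))) \<and>
    (\<forall>c \<in> eobj C. is_product V (map (ehom C c) bs) (ehom C c b)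
      (\<lambda>i. gcmp V C c b (bs ! i) (q i \<odot>\<^bsub>V\<^esub> bang V (ehom C c b)) (Idn V (ehom C c b))))"

section \<open>Universal cones as families of legs\<close>

context enriched_over_ccc begin

text \<open>\<open>cone_map\<close> is the tuple of the legs that occur in
  \<open>is_eproduct\<close>, so \<open>is_iso_iff_is_product\<close> applies to it.\<close>

lemma universal_cone_iff:
  "universal_cone V C b bs p \<longleftrightarrow>
    p \<in> hom V (one V) (Prd V (map (ehom C b) bs)) \<and>
    is_eproduct V C b bs (\<lambda>i. Prj V (map (ehom C b) bs) i \<odot> p)" (is "?L \<longleftrightarrow> ?R")
proof (cases "b \<in> eobj C \<and> set bs \<subseteq> eobj C \<and> p \<in> hom V (one V) (Prd V (map (ehom C b) bs))")
  case True
  then have bs [simp]: "b \<in> eobj C" "i < length bs \<Longrightarrow> bs ! i \<in> eobj C"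
    and p [simp]: "p \<in> Arr V" "Src V p = one V" "Tgt V p = Prd V (map (ehom C b) bs)" for i
    by auto
  have hs [simp]: "c \<in> eobj C \<Longrightarrow> set (map (ehom C c) bs) \<subseteq> Obj V" for c using True by auto
  have prj [simp]: "Prj V (map (ehom C b) bs) i \<in> Arr V"
    "Src V (Prj V (map (ehom C b) bs) i) = Prd V (map (ehom C b) bs)"
    "Tgt V (Prj V (map (ehom C b) bs) i) = ehom C b (bs ! i)" if "i < length bs" for i
    using prj_arr [OF hs, of b i] that by simp_all
  have "is_iso V (cone_map V C b bs p c) \<longleftrightarrow>
      is_product V (map (ehom C c) bs) (ehom C c b)
        (\<lambda>i. gcmp V C c b (bs ! i)
          ((Prj V (map (ehom C b) bs) i \<odot> p) \<odot> bang V (ehom C c b)) (Idn V (ehom C c b)))"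
    if c [simp]: "c \<in> eobj C" for c
  proof -
    let ?fs = "map (\<lambda>i. gcmp V C c b (bs ! i)
          ((Prj V (map (ehom C b) bs) i \<odot> p) \<odot> bang V (ehom C c b)) (Idn V (ehom C c b)))
          [0..<length bs]"
    have m: "map (Tgt V) ?fs = map (ehom C c) bs" by (rule nth_equalityI) simp_all
    have fs: "f \<in> Arr V \<and> Src V f = ehom C c b" if "f \<in> set ?fs" for f
      using that by auto
    have e: "cone_map V C b bs p c = tuple V (ehom C c b) ?fs"
      unfolding cone_map_def gcmp_def
      by (rule arg_cong [where f = "tuple V (ehom C c b)"], rule nth_equalityI) simp_all
    show ?thesis unfolding e
      using tuple_props [of "ehom C c b" ?fs, OF _ fs]
      by (intro is_iso_iff_is_product [OF prd [OF hs]]) (simp_all only: m, simp_all)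
  qed
  with True show ?thesis by (simp add: universal_cone_def is_eproduct_def)
next
  case False
  then show ?thesis by (auto simp: universal_cone_def is_eproduct_def)
qed

lemma is_eproductD:
  assumes "is_eproduct V C b bs q"
  shows "b \<in> eobj C" "i < length bs \<Longrightarrow> bs ! i \<in> eobj C"
    "i < length bs \<Longrightarrow> q i \<in> Arr V" "i < length bs \<Longrightarrow> Src V (q i) = one V"
    "i < length bs \<Longrightarrow> Tgt V (q i) = ehom C b (bs ! i)"
  using assms by (auto simp: is_eproduct_def)

lemma is_eproduct_cong:
  assumes "\<And>i. i < length bs \<Longrightarrow> q i = q' i"
  shows "is_eproduct V C b bs q \<longleftrightarrow> is_eproduct V C b bs q'"
proof -
  have "is_product V (map (ehom C c) bs) (ehom C c b)
      (\<lambda>i. gcmp V C c b (bs ! i) (q i \<odot> bang V (ehom C c b)) (Idn V (ehom C c b))) \<longleftrightarrow>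
    is_product V (map (ehom C c) bs) (ehom C c b)
      (\<lambda>i. gcmp V C c b (bs ! i) (q' i \<odot> bang V (ehom C c b)) (Idn V (ehom C c b)))" for c
    by (rule is_product_cong) (simp add: assms)
  then show ?thesis using assms by (simp add: is_eproduct_def)
qed

text \<open>Precomposing a leg with \<open>u\<close> replaces the identity in it by
  \<open>u\<close>, so the product property in V becomes a universal property of elements at every
  stage.\<close>

lemma is_eproduct_ext:
  assumes q: "is_eproduct V C b bs q" and c: "c \<in> eobj C"
    and u: "u \<in> hom V z (ehom C c b)" "u' \<in> hom V z (ehom C c b)"
    and eq: "\<And>i. i < length bs \<Longrightarrow>
      gcmp V C c b (bs ! i) (q i \<odot> bang V z) u = gcmp V C c b (bs ! i) (q i \<odot> bang V z) u'"
  shows "u = u'"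
proof (rule is_product_ext [OF _ u])
  show "is_product V (map (ehom C c) bs) (ehom C c b)
      (\<lambda>i. gcmp V C c b (bs ! i) (q i \<odot> bang V (ehom C c b)) (Idn V (ehom C c b)))"
    using q c by (simp add: is_eproduct_def)
  fix i assume "i < length (map (ehom C c) bs)"
  then show "gcmp V C c b (bs ! i) (q i \<odot> bang V (ehom C c b)) (Idn V (ehom C c b)) \<odot> u =
      gcmp V C c b (bs ! i) (q i \<odot> bang V (ehom C c b)) (Idn V (ehom C c b)) \<odot> u'"
    using is_eproductD [OF q] c u eq [of i] by simp
qed

lemma is_eproduct_exists:
  assumes q: "is_eproduct V C b bs q" and c: "c \<in> eobj C" and z: "z \<in> Obj V"
    and f: "\<And>i. i < length bs \<Longrightarrow> f i \<in> hom V z (ehom C c (bs ! i))"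
  shows "\<exists>u \<in> hom V z (ehom C c b). \<forall>i < length bs. gcmp V C c b (bs ! i) (q i \<odot> bang V z) u = f i"
proof -
  have "is_product V (map (ehom C c) bs) (ehom C c b)
      (\<lambda>i. gcmp V C c b (bs ! i) (q i \<odot> bang V (ehom C c b)) (Idn V (ehom C c b)))"
    using q c by (simp add: is_eproduct_def)
  from is_product_exists [OF this z, of f] f obtain u where u: "u \<in> hom V z (ehom C c b)"
    "\<forall>i < length bs. gcmp V C c b (bs ! i) (q i \<odot> bang V (ehom C c b)) (Idn V (ehom C c b)) \<odot> u = f i"
    by auto
  have "gcmp V C c b (bs ! i) (q i \<odot> bang V z) u = f i" if i: "i < length bs" for i
  proof -
    have "gcmp V C c b (bs ! i) (q i \<odot> bang V (ehom C c b)) (Idn V (ehom C c b)) \<odot> u =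
      gcmp V C c b (bs ! i) (q i \<odot> bang V z) u"
    using is_eproductD [OF q] c u(1) i by simp
    with u(2) i show ?thesis by simp
  qed
  with u(1) show ?thesis by blast
qed

lemma is_eproductI:
  assumes [simp]: "b \<in> eobj C" and bs: "set bs \<subseteq> eobj C"
    and q: "\<And>i. i < length bs \<Longrightarrow> q i \<in> hom V (one V) (ehom C b (bs ! i))"
    and ex: "\<And>c z f. \<lbrakk>c \<in> eobj C; z \<in> Obj V;
        \<And>i. i < length bs \<Longrightarrow> f i \<in> hom V z (ehom C c (bs ! i))\<rbrakk> \<Longrightarrow>
      \<exists>u \<in> hom V z (ehom C c b). \<forall>i < length bs. gcmp V C c b (bs ! i) (q i \<odot> bang V z) u = f i"
    and ext: "\<And>c z u u'. \<lbrakk>c \<in> eobj C; z \<in> Obj V; u \<in> hom V z (ehom C c b); u' \<in> hom V z (ehom C c b);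
        \<And>i. i < length bs \<Longrightarrow>
          gcmp V C c b (bs ! i) (q i \<odot> bang V z) u = gcmp V C c b (bs ! i) (q i \<odot> bang V z) u'\<rbrakk>
      \<Longrightarrow> u = u'"
  shows "is_eproduct V C b bs q"
proof -
  have bs_i [simp]: "i < length bs \<Longrightarrow> bs ! i \<in> eobj C" for i using bs by auto
  have q_i [simp]: "q i \<in> Arr V" "Src V (q i) = one V" "Tgt V (q i) = ehom C b (bs ! i)"
    if "i < length bs" for i using q [OF that] by auto
  have "is_product V (map (ehom C c) bs) (ehom C c b)
      (\<lambda>i. gcmp V C c b (bs ! i) (q i \<odot> bang V (ehom C c b)) (Idn V (ehom C c b)))"
    if [simp]: "c \<in> eobj C" for c
  proof -
    have leg: "gcmp V C c b (bs ! i) (q i \<odot> bang V (ehom C c b)) (Idn V (ehom C c b)) \<odot> u =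
        gcmp V C c b (bs ! i) (q i \<odot> bang V z) u"
      if "i < length bs" "u \<in> hom V z (ehom C c b)" for i u z
      using that by simp
    show ?thesis
    proof (rule is_productI)
      fix z f assume z: "z \<in> Obj V"
        and f: "\<And>i. i < length (map (ehom C c) bs) \<Longrightarrow> f i \<in> hom V z (map (ehom C c) bs ! i)"
      show "\<exists>h \<in> hom V z (ehom C c b). \<forall>i < length (map (ehom C c) bs).
          gcmp V C c b (bs ! i) (q i \<odot> bang V (ehom C c b)) (Idn V (ehom C c b)) \<odot> h = f i"
        using ex [of c z f, OF _ z] f leg by fastforce
    next
      fix z u u' assume "z \<in> Obj V" "u \<in> hom V z (ehom C c b)" "u' \<in> hom V z (ehom C c b)"
        and "\<And>i. i < length (map (ehom C c) bs) \<Longrightarrow>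
          gcmp V C c b (bs ! i) (q i \<odot> bang V (ehom C c b)) (Idn V (ehom C c b)) \<odot> u =
          gcmp V C c b (bs ! i) (q i \<odot> bang V (ehom C c b)) (Idn V (ehom C c b)) \<odot> u'"
      then show "u = u'" using leg by (intro ext [of c z u u']) auto
    qed simp_all
  qed
  then show ?thesis using bs q by (simp add: is_eproduct_def)
qed

lemma is_eproduct_cone:
  assumes q: "is_eproduct V C b bs q"
  obtains p where "universal_cone V C b bs p"
    "\<And>i. i < length bs \<Longrightarrow> Prj V (map (ehom C b) bs) i \<odot> p = q i"
proof -
  note D = is_eproductD [OF q]
  have m: "map (Tgt V) (map q [0..<length bs]) = map (ehom C b) bs"
    by (rule nth_equalityI) (simp_all add: D)
  have p: "tuple V (one V) (map q [0..<length bs]) \<in> hom V (one V) (Prd V (map (ehom C b) bs)) \<and>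
    (\<forall>i < length bs. Prj V (map (ehom C b) bs) i \<odot> tuple V (one V) (map q [0..<length bs]) = q i)"
    using tuple_props [of "one V" "map q [0..<length bs]"] D unfolding m by fastforce
  then have "is_eproduct V C b bs
      (\<lambda>i. Prj V (map (ehom C b) bs) i \<odot> tuple V (one V) (map q [0..<length bs]))"
    using q by (subst is_eproduct_cong [of _ _ q]) auto
  with p show ?thesis by (intro that) (auto simp: universal_cone_iff)
qed

end

section \<open>Enriched functors and preservation of products\<close>

locale enriched_functor_over_ccc =
  C: enriched_over_ccc V C + D: enriched_over_ccc V D + enriched_functor V C D f
  for V :: "('o, 'a, 'r) num_cat_scheme" (structure)
    and C :: "('c, 'o, 'a) ecat" and D :: "('d, 'o, 'a) ecat" and f :: "('c, 'd, 'a) efun"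
begin

lemma fhom_arr [simp]:
  "a \<in> eobj C \<Longrightarrow> fobj f a \<in> eobj D"
  "\<lbrakk>a \<in> eobj C; b \<in> eobj C\<rbrakk> \<Longrightarrow> fhom f a b \<in> Arr V"
  "\<lbrakk>a \<in> eobj C; b \<in> eobj C\<rbrakk> \<Longrightarrow> Src V (fhom f a b) = ehom C a b"
  "\<lbrakk>a \<in> eobj C; b \<in> eobj C\<rbrakk> \<Longrightarrow> Tgt V (fhom f a b) = ehom D (fobj f a) (fobj f b)"
  using fobj_in fhom_hom by auto

lemma fhom_gcmp:
  assumes "a \<in> eobj C" "b \<in> eobj C" "c \<in> eobj C" "h \<in> hom V z (ehom C a b)" "g \<in> hom V z (ehom C b c)"
  shows "fhom f a c \<odot> gcmp V C a b c g h =
    gcmp V D (fobj f a) (fobj f b) (fobj f c) (fhom f b c \<odot> g) (fhom f a b \<odot> h)"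
proof -
  have "fhom f a c \<odot> gcmp V C a b c g h = (fhom f a c \<odot> ecmp C a b c) \<odot> pair V g h"
    using assms by (simp add: gcmp_def)
  also have "\<dots> = (ecmp D (fobj f a) (fobj f b) (fobj f c) \<odot> pmap V (fhom f b c) (fhom f a b)) \<odot> pair V g h"
    using fhom_cmp [of a b c] assms by simp
  finally show ?thesis using assms by (simp add: gcmp_def pmap_def)
qed

text \<open>A point of a chosen product and its components determine each other, so bundled cones
  and families of legs carry the same condition. In this form change of base acts leg by
  leg.\<close>

lemma preserves_finite_eproducts_iff:
  "preserves_finite_eproducts V C D f \<longleftrightarrow>
    (\<forall>b bs q. is_eproduct V C b bs q \<longrightarrow>
      is_eproduct V D (fobj f b) (map (fobj f) bs) (\<lambda>i. fhom f b (bs ! i) \<odot> q i))"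
proof -
  have image: "universal_cone V D (fobj f b) (map (fobj f) bs) (image_cone V C f b bs p) \<longleftrightarrow>
      is_eproduct V D (fobj f b) (map (fobj f) bs) (\<lambda>i. fhom f b (bs ! i) \<odot> q i)"
    if p: "universal_cone V C b bs p"
      and q: "\<And>i. i < length bs \<Longrightarrow> Prj V (map (ehom C b) bs) i \<odot> p = q i" for b bs p q
  proof -
    have P: "is_eproduct V C b bs q"
      using p C.is_eproduct_cong [of bs _ q b, OF q] by (simp only: C.universal_cone_iff)
    note D = C.is_eproductD [OF P]
    let ?bs = "map (fobj f) bs"
    let ?fs = "map (\<lambda>i. fhom f b (bs ! i) \<odot> q i) [0..<length bs]"
    have m: "map (Tgt V) ?fs = map (ehom D (fobj f b)) ?bs"
      by (rule nth_equalityI) (simp_all add: D)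
    have i: "image_cone V C f b bs p = tuple V (one V) ?fs"
      unfolding image_cone_def
      by (rule arg_cong [where f = "tuple V (one V)"], rule nth_equalityI) (simp_all add: q)
    have t: "tuple V (one V) ?fs \<in> hom V (one V) (Prd V (map (ehom D (fobj f b)) ?bs)) \<and>
      (\<forall>i < length bs. Prj V (map (ehom D (fobj f b)) ?bs) i \<odot> tuple V (one V) ?fs =
        fhom f b (bs ! i) \<odot> q i)"
      using C.tuple_props [of "one V" ?fs] D unfolding m by fastforce
    show ?thesis
      unfolding i D.universal_cone_iff
      using t D.is_eproduct_cong [of ?bs "\<lambda>i. Prj V (map (ehom D (fobj f b)) ?bs) i \<odot> tuple V (one V) ?fs"
        "\<lambda>i. fhom f b (bs ! i) \<odot> q i" "fobj f b"] by simp
  qed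
  show ?thesis
    unfolding preserves_finite_eproducts_def
  proof (intro iffI allI impI)
    fix b bs q
    assume pres: "\<forall>b bs p. universal_cone V C b bs p \<longrightarrow>
        universal_cone V D (fobj f b) (map (fobj f) bs) (image_cone V C f b bs p)"
      and q: "is_eproduct V C b bs q"
    from C.is_eproduct_cone [OF q] obtain p where p: "universal_cone V C b bs p"
      "\<And>i. i < length bs \<Longrightarrow> Prj V (map (ehom C b) bs) i \<odot> p = q i" by blast
    with pres show "is_eproduct V D (fobj f b) (map (fobj f) bs) (\<lambda>i. fhom f b (bs ! i) \<odot> q i)"
      using image [OF p] by blast
  next
    fix b bs p
    assume pres: "\<forall>b bs q. is_eproduct V C b bs q \<longrightarrow>
        is_eproduct V D (fobj f b) (map (fobj f) bs) (\<lambda>i. fhom f b (bs ! i) \<odot> q i)"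
      and p: "universal_cone V C b bs p"
    then have "is_eproduct V C b bs (\<lambda>i. Prj V (map (ehom C b) bs) i \<odot> p)"
      by (simp add: C.universal_cone_iff)
    with pres show "universal_cone V D (fobj f b) (map (fobj f) bs) (image_cone V C f b bs p)"
      using image [OF p] by simp
  qed
qed

text \<open>Since products are unique up to isomorphism, it suffices to preserve one cone per family.\<close>

lemma is_eproduct_image:
  assumes p: "is_eproduct V C b bs p"
    and fp: "is_eproduct V D (fobj f b) (map (fobj f) bs) (\<lambda>i. fhom f b (bs ! i) \<odot> p i)"
    and q: "is_eproduct V C b' bs q"
  shows "is_eproduct V D (fobj f b') (map (fobj f) bs) (\<lambda>i. fhom f b' (bs ! i) \<odot> q i)"
proof -
  note P = C.is_eproductD [OF p] and Q = C.is_eproductD [OF q]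
  let ?g = "gcmp V C" and ?h = "gcmp V D" let ?F = "fobj f"
  \<comment> \<open>\<open>u\<close> and \<open>v\<close> are the comparisons between the two
    products. They are mutually inverse because either composite has the same components as an
    identity.\<close>
  obtain u where u: "u \<in> hom V (one V) (ehom C b' b)"
    and pu: "\<And>i. i < length bs \<Longrightarrow> ?g b' b (bs ! i) (p i) u = q i"
    using C.is_eproduct_exists [OF p Q(1), of "one V" q] P Q by auto
  obtain v where v: "v \<in> hom V (one V) (ehom C b b')"
    and qv: "\<And>i. i < length bs \<Longrightarrow> ?g b b' (bs ! i) (q i) v = p i"
    using C.is_eproduct_exists [OF q P(1), of "one V" p] P Q by auto
  have uv: "?g b b' b u v = eid C b"
  proof (rule C.is_eproduct_ext [OF p P(1)])
    fix i assume i: "i < length bs"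
    have "?g b b (bs ! i) (p i) (?g b b' b u v) = ?g b b' (bs ! i) (?g b' b (bs ! i) (p i) u) v"
      by (rule C.gcmp_assoc [symmetric]) (use P Q u v i in auto)
    also have "\<dots> = p i" using pu qv i by simp
    also have "\<dots> = ?g b b (bs ! i) (p i) (eid C b)"
      using C.gcmp_eid_right [of b "bs ! i" "p i" "one V"] P i by simp
    finally show "?g b b (bs ! i) (p i \<odot> bang V (one V)) (?g b b' b u v) =
        ?g b b (bs ! i) (p i \<odot> bang V (one V)) (eid C b)" using P i by simp
  qed (use P Q u v in auto)
  have vu: "?g b' b b' v u = eid C b'"
  proof (rule C.is_eproduct_ext [OF q Q(1)])
    fix i assume i: "i < length bs"
    have "?g b' b' (bs ! i) (q i) (?g b' b b' v u) = ?g b' b (bs ! i) (?g b b' (bs ! i) (q i) v) u"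
      by (rule C.gcmp_assoc [symmetric]) (use P Q u v i in auto)
    also have "\<dots> = q i" using pu qv i by simp
    also have "\<dots> = ?g b' b' (bs ! i) (q i) (eid C b')"
      using C.gcmp_eid_right [of b' "bs ! i" "q i" "one V"] Q i by simp
    finally show "?g b' b' (bs ! i) (q i \<odot> bang V (one V)) (?g b' b b' v u) =
        ?g b' b' (bs ! i) (q i \<odot> bang V (one V)) (eid C b')" using Q i by simp
  qed (use P Q u v in auto)
  \<comment> \<open>The functor preserves composition and identities, so the images of
    \<open>u\<close> and \<open>v\<close> are again mutually inverse.\<close>
  define U where "U = fhom f b' b \<odot> u"
  define Y where "Y = fhom f b b' \<odot> v"
  have U [simp]: "U \<in> Arr V" "Src V U = one V" "Tgt V U = ehom D (?F b') (?F b)"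
    and Y [simp]: "Y \<in> Arr V" "Src V Y = one V" "Tgt V Y = ehom D (?F b) (?F b')"
    using P Q u v by (auto simp: U_def Y_def)
  have UY: "?h (?F b) (?F b') (?F b) U Y = eid D (?F b)"
    using fhom_gcmp [of b b' b v "one V" u] P Q u v uv fhom_id [of b] by (simp add: U_def Y_def)
  have YU: "?h (?F b') (?F b) (?F b') Y U = eid D (?F b')"
    using fhom_gcmp [of b' b b' u "one V" v] P Q u v vu fhom_id [of b'] by (simp add: U_def Y_def)
  have PU: "?h (?F b') (?F b) (?F (bs ! i)) (fhom f b (bs ! i) \<odot> p i) U = fhom f b' (bs ! i) \<odot> q i"
    if "i < length bs" for i
    using fhom_gcmp [of b' b "bs ! i" u "one V" "p i"] P Q u pu that by (simp add: U_def)
  have b [simp]: "b \<in> eobj C" "b' \<in> eobj C" using P Q by auto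
  have bsi [simp]: "i < length bs \<Longrightarrow> bs ! i \<in> eobj C" for i by (rule P(2))
  show ?thesis
  proof (rule D.is_eproductI)
    \<comment> \<open>The image of the \<open>q\<close>-cone is the image of the
      \<open>p\<close>-cone precomposed with \<open>U\<close>, so both halves of its universal
      property follow from \<open>fp\<close> through the inverse \<open>Y\<close>.\<close>
    have QW: "?h c (?F b') (?F (bs ! i)) ((fhom f b' (bs ! i) \<odot> q i) \<odot> bang V z) w =
        ?h c (?F b) (?F (bs ! i)) ((fhom f b (bs ! i) \<odot> p i) \<odot> bang V z)
          (?h c (?F b') (?F b) (U \<odot> bang V z) w)"
      if "c \<in> eobj D" "w \<in> hom V z (ehom D c (?F b'))" "i < length bs" for c z w i
    proof -
      have z: "z \<in> Obj V" using that(2) by auto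
      have "(fhom f b' (bs ! i) \<odot> q i) \<odot> bang V z =
          ?h (?F b') (?F b) (?F (bs ! i)) ((fhom f b (bs ! i) \<odot> p i) \<odot> bang V z) (U \<odot> bang V z)"
        unfolding PU [OF that(3), symmetric] using z that P(3-5) [OF that(3)] by simp
      then show ?thesis
        using D.gcmp_assoc [of c "?F b'" "?F b" "?F (bs ! i)" w z "U \<odot> bang V z"
          "(fhom f b (bs ! i) \<odot> p i) \<odot> bang V z"] z that P(3-5) [OF that(3)] by simp
    qed
    {
      fix c z g assume c: "c \<in> eobj D" and z: "z \<in> Obj V"
        and g: "\<And>i. i < length (map ?F bs) \<Longrightarrow> g i \<in> hom V z (ehom D c (map ?F bs ! i))"
      obtain w where w: "w \<in> hom V z (ehom D c (?F b))"
        "\<And>i. i < length bs \<Longrightarrow> ?h c (?F b) (?F (bs ! i)) ((fhom f b (bs ! i) \<odot> p i) \<odot> bang V z) w = g i"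
        using D.is_eproduct_exists [OF fp c z g] by auto
      \<comment> \<open>\<open>w\<close> solves the problem for \<open>b\<close>; its transport
        along \<open>Y\<close> solves it for \<open>b'\<close>, because \<open>U\<close> undoes
        \<open>Y\<close>.\<close>
      let ?w = "?h c (?F b) (?F b') (Y \<odot> bang V z) w"
      have "?h c (?F b') (?F b) (U \<odot> bang V z) ?w =
          ?h c (?F b) (?F b) (?h (?F b) (?F b') (?F b) U Y \<odot> bang V z) w"
        using D.gcmp_assoc [of c "?F b" "?F b'" "?F b" w z "Y \<odot> bang V z" "U \<odot> bang V z"] w(1) c z
        by simp
      also have "\<dots> = w" using w(1) c z by (simp add: UY)
      finally have "?h c (?F b') (?F b) (U \<odot> bang V z) ?w = w" .
      then show "\<exists>w \<in> hom V z (ehom D c (?F b')). \<forall>i < length (map ?F bs).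
          ?h c (?F b') (map ?F bs ! i) ((fhom f b' (bs ! i) \<odot> q i) \<odot> bang V z) w = g i"
        using w c z QW [of c ?w z] by (intro bexI [of _ ?w]) auto
    next
      fix c z w w' assume c: "c \<in> eobj D" and z: "z \<in> Obj V"
        and w: "w \<in> hom V z (ehom D c (?F b'))" "w' \<in> hom V z (ehom D c (?F b'))"
        and e: "\<And>i. i < length (map ?F bs) \<Longrightarrow>
          ?h c (?F b') (map ?F bs ! i) ((fhom f b' (bs ! i) \<odot> q i) \<odot> bang V z) w =
          ?h c (?F b') (map ?F bs ! i) ((fhom f b' (bs ! i) \<odot> q i) \<odot> bang V z) w'"
      have "?h c (?F b') (?F b) (U \<odot> bang V z) w = ?h c (?F b') (?F b) (U \<odot> bang V z) w'"
        by (rule D.is_eproduct_ext [OF fp c]) (use w c z e QW [of c] in auto)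
      moreover have "?h c (?F b) (?F b') (Y \<odot> bang V z) (?h c (?F b') (?F b) (U \<odot> bang V z) x) = x"
        if "x \<in> hom V z (ehom D c (?F b'))" for x
      proof -
        have "?h c (?F b) (?F b') (Y \<odot> bang V z) (?h c (?F b') (?F b) (U \<odot> bang V z) x) =
          ?h c (?F b') (?F b') (?h (?F b') (?F b) (?F b') Y U \<odot> bang V z) x"
          using D.gcmp_assoc [of c "?F b'" "?F b" "?F b'" x z "U \<odot> bang V z" "Y \<odot> bang V z"] that c z
          by simp
        then show ?thesis using that c z by (simp add: YU)
      qed
      ultimately show "w = w'" using w by metis
    }
  qed (use P Q in \<open>auto simp: in_set_conv_nth\<close>)
qed

end

section \<open>Change of base\<close>

locale cartesian_base_change = V: num_ccc V + W: num_ccc W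
  for V :: "('o, 'a, 'r) num_cat_scheme" and W :: "('p, 'b, 's) num_cat_scheme"
    and F :: "('o, 'a, 'p, 'b) func" +
  assumes cartesian: "cartesian_functor V W F"
begin

sublocale F: cat_functor V W F
  using cartesian by (simp add: cartesian_functor_def)

lemma F_product:
  "\<lbrakk>set xs \<subseteq> Obj V; is_product V xs p \<pi>\<rbrakk> \<Longrightarrow>
    is_product W (map (ob F) xs) (ob F p) (\<lambda>i. ar F (\<pi> i))"
  using cartesian by (simp add: cartesian_functor_def)

lemma F_arr [simp]:
  "x \<in> Obj V \<Longrightarrow> ob F x \<in> Obj W"
  "f \<in> Arr V \<Longrightarrow> ar F f \<in> Arr W"
  "f \<in> Arr V \<Longrightarrow> Src W (ar F f) = ob F (Src V f)"
  "f \<in> Arr V \<Longrightarrow> Tgt W (ar F f) = ob F (Tgt V f)"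
  "x \<in> Obj V \<Longrightarrow> ar F (Idn V x) = Idn W (ob F x)"
  using F.ob_in F.ar_hom [of f "Src V f" "Tgt V f"] F.ar_idn by auto

lemma F_cmp [simp]:
  "\<lbrakk>f \<in> Arr V; g \<in> Arr V; Src V g = Tgt V f\<rbrakk> \<Longrightarrow> ar F (g \<odot>\<^bsub>V\<^esub> f) = ar F g \<odot>\<^bsub>W\<^esub> ar F f"
  using F.ar_cmp [of f "Src V f" "Tgt V f" g "Tgt V g"] by auto

abbreviation cmp where "cmp \<equiv> prd_comparison V W F"

lemma cmp_props:
  assumes "set xs \<subseteq> Obj V"
  shows "cmp xs \<in> hom W (Prd W (map (ob F) xs)) (ob F (Prd V xs)) \<and>
    (\<forall>i < length xs. ar F (Prj V xs i) \<odot>\<^bsub>W\<^esub> cmp xs = Prj W (map (ob F) xs) i)"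
proof -
  have s: "set (map (ob F) xs) \<subseteq> Obj W" using assms by auto
  have "\<exists>!h. h \<in> hom W (Prd W (map (ob F) xs)) (ob F (Prd V xs)) \<and>
    (\<forall>i < length (map (ob F) xs). ar F (Prj V xs i) \<odot>\<^bsub>W\<^esub> h = Prj W (map (ob F) xs) i)"
    by (rule W.is_product_ex1 [OF F_product [OF assms V.prd [OF assms]]])
      (use W.prd_obj [OF s] W.prj_arr [OF s] in simp_all)
  then have "\<exists>!h. h \<in> hom W (Prd W (map (ob F) xs)) (ob F (Prd V xs)) \<and>
    (\<forall>i < length xs. ar F (Prj V xs i) \<odot>\<^bsub>W\<^esub> h = Prj W (map (ob F) xs) i)"
    unfolding length_map .
  then show ?thesis unfolding prd_comparison_def by (rule theI')
qed

lemma cmp_arr [simp]: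
  assumes "set xs \<subseteq> Obj V"
  shows "cmp xs \<in> Arr W" "Src W (cmp xs) = Prd W (map (ob F) xs)"
    "Tgt W (cmp xs) = ob F (Prd V xs)"
  using cmp_props [OF assms] by auto

lemma F_prd_ext:
  assumes "set xs \<subseteq> Obj V" "h \<in> hom W z (ob F (Prd V xs))" "h' \<in> hom W z (ob F (Prd V xs))"
    and "\<And>i. i < length xs \<Longrightarrow> ar F (Prj V xs i) \<odot>\<^bsub>W\<^esub> h = ar F (Prj V xs i) \<odot>\<^bsub>W\<^esub> h'"
  shows "h = h'"
  using assms(4)
  by (intro W.is_product_ext [OF F_product [OF assms(1) V.prd [OF assms(1)]] assms(2,3)]) simp

lemma F_prd_exists:
  assumes "set xs \<subseteq> Obj V" "z \<in> Obj W" "\<And>i. i < length xs \<Longrightarrow> f i \<in> hom W z (ob F (xs ! i))"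
  shows "\<exists>h \<in> hom W z (ob F (Prd V xs)). \<forall>i < length xs. ar F (Prj V xs i) \<odot>\<^bsub>W\<^esub> h = f i"
  using W.is_product_exists [OF F_product [OF assms(1) V.prd [OF assms(1)]] assms(2), of f] assms(3)
  by simp

text \<open>The images of the projections are jointly monic, since \<open>F\<close> preserves the
  product; both sides have the same components.\<close>

lemma F_pair [simp]:
  assumes "f \<in> Arr V" "g \<in> Arr V" "Src V f = Src V g"
  shows "ar F (pair V f g) = cmp [Tgt V f, Tgt V g] \<odot>\<^bsub>W\<^esub> pair W (ar F f) (ar F g)"
proof (rule F_prd_ext [of "[Tgt V f, Tgt V g]"])
  let ?xs = "[Tgt V f, Tgt V g]"
  have c: "\<forall>i < length ?xs. ar F (Prj V ?xs i) \<odot>\<^bsub>W\<^esub> cmp ?xs = Prj W (map (ob F) ?xs) i"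
    using cmp_props [of ?xs] assms by auto
  have "\<forall>i < length ?xs. ar F (Prj V ?xs i) \<odot>\<^bsub>W\<^esub> ar F (pair V f g) =
      (ar F (Prj V ?xs i) \<odot>\<^bsub>W\<^esub> cmp ?xs) \<odot>\<^bsub>W\<^esub> pair W (ar F f) (ar F g)"
    unfolding V.all_less_two using c [unfolded V.all_less_two] assms
    by (simp del: W.assoc_simp F_cmp add: F_cmp [symmetric])
  then show "ar F (Prj V ?xs i) \<odot>\<^bsub>W\<^esub> ar F (pair V f g) =
      ar F (Prj V ?xs i) \<odot>\<^bsub>W\<^esub> cmp ?xs \<odot>\<^bsub>W\<^esub> pair W (ar F f) (ar F g)" if "i < length ?xs" for i
    using assms that V.prj_arr [of ?xs i] by auto
qed (use assms in auto)

lemma F_bang [simp]: "z \<in> Obj V \<Longrightarrow> ar F (bang V z) = cmp [] \<odot>\<^bsub>W\<^esub> bang W (ob F z)"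
  by (rule F_prd_ext [of "[]"]) auto

lemma base_change_simps [simp]:
  "eobj (base_change V W F C) = eobj C"
  "ehom (base_change V W F C) a b = ob F (ehom C a b)"
  "eid (base_change V W F C) a = ar F (eid C a) \<odot>\<^bsub>W\<^esub> cmp []"
  "ecmp (base_change V W F C) a b c = ar F (ecmp C a b c) \<odot>\<^bsub>W\<^esub> cmp [ehom C b c, ehom C a b]"
  by (simp_all add: base_change_def)

lemma base_change_fun_simps [simp]:
  "fobj (base_change_fun F f) a = fobj f a" "fobj (base_change_fun F f) = fobj f"
  "fhom (base_change_fun F f) a b = ar F (fhom f a b)"
  by (simp_all add: base_change_fun_def)

end

section \<open>Change of base for enriched categories\<close>

locale enriched_base_change = cartesian_base_change V W F + C: enriched_over_ccc V C
  for V :: "('o, 'a, 'r) num_cat_scheme" and W :: "('p, 'b, 's) num_cat_scheme"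
    and F :: "('o, 'a, 'p, 'b) func" and C :: "('c, 'o, 'a) ecat"
begin

abbreviation "FC \<equiv> base_change V W F C"

text \<open>The \<open>cmp\<close> that \<open>F_pair\<close> produces is the one built into the
  composition of \<open>FC\<close>, so \<open>F\<close> commutes strictly with composition of
  elements.\<close>

lemma F_gcmp:
  assumes "a \<in> eobj C" "b \<in> eobj C" "c \<in> eobj C" "f \<in> hom V z (ehom C a b)" "g \<in> hom V z (ehom C b c)"
  shows "ar F (gcmp V C a b c g f) = gcmp W FC a b c (ar F g) (ar F f)"
  using assms by (simp add: gcmp_def)

lemma gcmp_F_cmp:
  assumes "a \<in> eobj C" "b \<in> eobj C" "c \<in> eobj C" "f \<in> hom V z (ehom C a b)" "g \<in> hom V z (ehom C b c)"
    "t \<in> Arr W" "Tgt W t = ob F z"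
  shows "gcmp W FC a b c (ar F g \<odot>\<^bsub>W\<^esub> t) (ar F f \<odot>\<^bsub>W\<^esub> t) = ar F (gcmp V C a b c g f) \<odot>\<^bsub>W\<^esub> t"
  using assms by (simp add: gcmp_def)

text \<open>The laws of \<open>C\<close> are applied to universal elements: the three projections
  for associativity, the identity of the hom-object for the units. Any elements in W are
  restrictions of the images of these.\<close>

lemma enriched_category_base_change: "enriched_category W FC"
proof (rule W.enriched_categoryI)
  fix a b c d z f g h
  assume abcd: "a \<in> eobj FC" "b \<in> eobj FC" "c \<in> eobj FC" "d \<in> eobj FC"
    and z: "z \<in> Obj W" and f: "f \<in> hom W z (ehom FC a b)" and g: "g \<in> hom W z (ehom FC b c)"
    and h: "h \<in> hom W z (ehom FC c d)"
  define xs where "xs = [ehom C c d, ehom C b c, ehom C a b]"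
  have xs: "set xs \<subseteq> Obj V" using abcd by (simp add: xs_def)
  define \<pi> where "\<pi> = Prj V xs"
  have p: "\<pi> 0 \<in> hom V (Prd V xs) (ehom C c d)" "\<pi> 1 \<in> hom V (Prd V xs) (ehom C b c)"
    "\<pi> 2 \<in> hom V (Prd V xs) (ehom C a b)"
    using V.prj_arr [OF xs, of 0] V.prj_arr [OF xs, of 1] V.prj_arr [OF xs, of 2]
    by (simp_all add: xs_def \<pi>_def numeral_2_eq_2)
  have "\<exists>t \<in> hom W z (ob F (Prd V xs)). \<forall>i < length xs. ar F (\<pi> i) \<odot>\<^bsub>W\<^esub> t = [h, g, f] ! i"
    unfolding \<pi>_def
    by (rule F_prd_exists [OF xs z]) (use f g h in \<open>auto simp: xs_def less_Suc_eq\<close>)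
  then obtain t where t: "t \<in> hom W z (ob F (Prd V xs))"
    and e: "h = ar F (\<pi> 0) \<odot>\<^bsub>W\<^esub> t" "g = ar F (\<pi> 1) \<odot>\<^bsub>W\<^esub> t" "f = ar F (\<pi> 2) \<odot>\<^bsub>W\<^esub> t"
    by (auto simp: xs_def less_Suc_eq all_conj_distrib numeral_2_eq_2 One_nat_def)
  show "gcmp W FC a b d (gcmp W FC b c d h g) f = gcmp W FC a c d h (gcmp W FC a b c g f)"
    using abcd t p C.gcmp_assoc [of a b c d "\<pi> 2" "Prd V xs" "\<pi> 1" "\<pi> 0"]
    by (simp add: e gcmp_F_cmp [where z = "Prd V xs"])
next
  fix a b z f
  assume ab: "a \<in> eobj FC" "b \<in> eobj FC"
    and z: "z \<in> Obj W" and f: "f \<in> hom W z (ehom FC a b)"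
  let ?x = "ehom C a b"
  \<comment> \<open>For the unit laws the restricting morphism is \<open>f\<close> itself. The unit
    element is also a restriction along \<open>f\<close>, because maps into the terminal object are
    unique.\<close>
  have "(ar F (eid C b) \<odot>\<^bsub>W\<^esub> cmp []) \<odot>\<^bsub>W\<^esub> bang W z = ar F (eid C b \<odot>\<^bsub>V\<^esub> bang V ?x) \<odot>\<^bsub>W\<^esub> f"
    using ab f z by simp
  moreover have "(ar F (eid C a) \<odot>\<^bsub>W\<^esub> cmp []) \<odot>\<^bsub>W\<^esub> bang W z = ar F (eid C a \<odot>\<^bsub>V\<^esub> bang V ?x) \<odot>\<^bsub>W\<^esub> f"
    using ab f z by simp
  moreover have "f = ar F (Idn V ?x) \<odot>\<^bsub>W\<^esub> f" using ab f z by simp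
  ultimately show "gcmp W FC a b b (eid FC b \<odot>\<^bsub>W\<^esub> bang W z) f = f"
    "gcmp W FC a a b f (eid FC a \<odot>\<^bsub>W\<^esub> bang W z) = f"
    using ab f gcmp_F_cmp [of a b b "Idn V ?x" ?x "eid C b \<odot>\<^bsub>V\<^esub> bang V ?x" f]
      gcmp_F_cmp [of a a b "eid C a \<odot>\<^bsub>V\<^esub> bang V ?x" ?x "Idn V ?x" f]
    by simp_all
qed simp_all

sublocale FC: enriched_over_ccc W FC
  by (intro enriched_over_ccc.intro W.num_ccc_axioms enriched_category_base_change)

text \<open>\<open>F\<close> carries the product cone at each \<open>c\<close> to a product cone in
  W, and \<open>F_gcmp\<close> identifies its legs. The factor \<open>cmp []\<close> is the map from
  the terminal object of W to the image of that of V, so that legs become points again.\<close>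

lemma is_eproduct_base_change:
  assumes q: "is_eproduct V C b bs q"
  shows "is_eproduct W FC b bs (\<lambda>i. ar F (q i) \<odot>\<^bsub>W\<^esub> cmp [])"
proof -
  note Q = C.is_eproductD [OF q]
  have "is_product W (map (ehom FC c) bs) (ehom FC c b)
      (\<lambda>i. gcmp W FC c b (bs ! i) ((ar F (q i) \<odot>\<^bsub>W\<^esub> cmp []) \<odot>\<^bsub>W\<^esub> bang W (ehom FC c b))
        (Idn W (ehom FC c b)))" if c: "c \<in> eobj C" for c
  proof -
    let ?l = "\<lambda>i. gcmp V C c b (bs ! i) (q i \<odot>\<^bsub>V\<^esub> bang V (ehom C c b)) (Idn V (ehom C c b))"
    have "set (map (ehom C c) bs) \<subseteq> Obj V"
      using q c by (auto simp: is_eproduct_def)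
    moreover have "is_product V (map (ehom C c) bs) (ehom C c b) ?l"
      using q c by (simp add: is_eproduct_def)
    ultimately have "is_product W (map (ob F) (map (ehom C c) bs)) (ob F (ehom C c b)) (\<lambda>i. ar F (?l i))"
      by (rule F_product)
    then have l: "is_product W (map (ehom FC c) bs) (ehom FC c b) (\<lambda>i. ar F (?l i))"
      by (simp add: base_change_def comp_def)
    have e: "ar F (?l i) = gcmp W FC c b (bs ! i)
        ((ar F (q i) \<odot>\<^bsub>W\<^esub> cmp []) \<odot>\<^bsub>W\<^esub> bang W (ehom FC c b)) (Idn W (ehom FC c b))"
      if "i < length (map (ehom FC c) bs)" for i
      using Q(1) Q(2-5) [of i] that c
      by (subst F_gcmp [where z = "ehom C c b"]) simp_all
    show ?thesis by (rule iffD1 [OF W.is_product_cong l]) (rule e)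
  qed
  then show ?thesis using q by (simp add: is_eproduct_def)
qed

end

section \<open>Change of base for enriched functors\<close>

locale functor_base_change = cartesian_base_change V W F + f: enriched_functor_over_ccc V C D f
  for V :: "('o, 'a, 'r) num_cat_scheme" and W :: "('p, 'b, 's) num_cat_scheme"
    and F :: "('o, 'a, 'p, 'b) func" and C :: "('c, 'o, 'a) ecat"
    and D :: "('d, 'o, 'a) ecat" and f :: "('c, 'd, 'a) efun"
begin

sublocale C: enriched_base_change V W F C ..
sublocale D: enriched_base_change V W F D ..

sublocale Ff: enriched_functor_over_ccc W C.FC D.FC "base_change_fun F f"
proof
  fix a b c assume a: "a \<in> eobj C.FC"
  have "ar F (fhom f a a) \<odot>\<^bsub>W\<^esub> ar F (eid C a) = ar F (eid D (fobj f a))"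
    using a f.fhom_id [of a] by (simp del: F_cmp add: F_cmp [symmetric])
  then have "(ar F (fhom f a a) \<odot>\<^bsub>W\<^esub> ar F (eid C a)) \<odot>\<^bsub>W\<^esub> cmp [] = ar F (eid D (fobj f a)) \<odot>\<^bsub>W\<^esub> cmp []"
    by simp
  then show "fhom (base_change_fun F f) a a \<odot>\<^bsub>W\<^esub> eid C.FC a = eid D.FC (fobj (base_change_fun F f) a)"
    using a by simp
  assume b: "b \<in> eobj C.FC" and c: "c \<in> eobj C.FC"
  have "ar F (fhom f a c) \<odot>\<^bsub>W\<^esub> ar F (ecmp C a b c) = ar F (ecmp D (fobj f a) (fobj f b) (fobj f c) \<odot>\<^bsub>V\<^esub>
      pmap V (fhom f b c) (fhom f a b))"
    using a b c f.fhom_cmp [of a b c] by (simp del: F_cmp add: F_cmp [symmetric])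
  then have "(ar F (fhom f a c) \<odot>\<^bsub>W\<^esub> ar F (ecmp C a b c)) \<odot>\<^bsub>W\<^esub> cmp [ehom C b c, ehom C a b] =
    ar F (ecmp D (fobj f a) (fobj f b) (fobj f c) \<odot>\<^bsub>V\<^esub>
      pmap V (fhom f b c) (fhom f a b)) \<odot>\<^bsub>W\<^esub> cmp [ehom C b c, ehom C a b]" by simp
  \<comment> \<open>Together with \<open>F_pair\<close>, these equations give the naturality of
    \<open>cmp\<close> in \<open>fhom f b c\<close> and \<open>fhom f a b\<close>.\<close>
  moreover have "ar F (pr1 V (ehom C b c) (ehom C a b)) \<odot>\<^bsub>W\<^esub> cmp [ehom C b c, ehom C a b] =
      pr1 W (ob F (ehom C b c)) (ob F (ehom C a b))"
    "ar F (pr2 V (ehom C b c) (ehom C a b)) \<odot>\<^bsub>W\<^esub> cmp [ehom C b c, ehom C a b] =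
      pr2 W (ob F (ehom C b c)) (ob F (ehom C a b))"
    using cmp_props [of "[ehom C b c, ehom C a b]"] a b c unfolding V.all_less_two by auto
  ultimately show "fhom (base_change_fun F f) a c \<odot>\<^bsub>W\<^esub> ecmp C.FC a b c =
    ecmp D.FC (fobj (base_change_fun F f) a) (fobj (base_change_fun F f) b) (fobj (base_change_fun F f) c)
      \<odot>\<^bsub>W\<^esub> pmap W (fhom (base_change_fun F f) b c) (fhom (base_change_fun F f) a b)"
    using a b c by (simp add: pmap_def)
qed (auto)

lemma preserves_finite_eproducts_base_change:
  assumes pres: "preserves_finite_eproducts V C D f"
    and ex: "\<And>bs. set bs \<subseteq> eobj C \<Longrightarrow> \<exists>b p. is_eproduct V C b bs p"
  shows "preserves_finite_eproducts W C.FC D.FC (base_change_fun F f)"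
  unfolding Ff.preserves_finite_eproducts_iff
proof (intro allI impI)
  fix b bs q assume q: "is_eproduct W C.FC b bs q"
  then have bs: "set bs \<subseteq> eobj C" by (simp add: is_eproduct_def)
  \<comment> \<open>The object \<open>a\<close> may differ from \<open>b\<close>, and
    \<open>p\<close> is unrelated to \<open>q\<close>; only the family \<open>bs\<close> is shared,
    which is enough for \<open>is_eproduct_image\<close>.\<close>
  then obtain a p where p: "is_eproduct V C a bs p" using ex by blast
  note P = f.C.is_eproductD [OF p]
  have "is_eproduct V D (fobj f a) (map (fobj f) bs) (\<lambda>i. fhom f a (bs ! i) \<odot>\<^bsub>V\<^esub> p i)"
    using pres p by (simp add: f.preserves_finite_eproducts_iff)
  then have "is_eproduct W D.FC (fobj f a) (map (fobj f) bs)
      (\<lambda>i. ar F (fhom f a (bs ! i) \<odot>\<^bsub>V\<^esub> p i) \<odot>\<^bsub>W\<^esub> cmp [])"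
    by (rule D.is_eproduct_base_change)
  then have "is_eproduct W D.FC (fobj (base_change_fun F f) a) (map (fobj (base_change_fun F f)) bs)
      (\<lambda>i. fhom (base_change_fun F f) a (bs ! i) \<odot>\<^bsub>W\<^esub> ar F (p i) \<odot>\<^bsub>W\<^esub> cmp [])"
    using P by (subst D.FC.is_eproduct_cong
        [of _ _ "\<lambda>i. ar F (fhom f a (bs ! i) \<odot>\<^bsub>V\<^esub> p i) \<odot>\<^bsub>W\<^esub> cmp []"]) simp_all
  then show "is_eproduct W D.FC (fobj (base_change_fun F f) b) (map (fobj (base_change_fun F f)) bs)
      (\<lambda>i. fhom (base_change_fun F f) b (bs ! i) \<odot>\<^bsub>W\<^esub> q i)"
    by (rule Ff.is_eproduct_image [OF C.is_eproduct_base_change [OF p] _ q])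
qed

end

section \<open>Arities\<close>

context num_ccc begin

lemma num_arr [simp]:
  "Num V n \<in> Obj V" "k < n \<Longrightarrow> Inj V n k \<in> Arr V" "k < n \<Longrightarrow> Src V (Inj V n k) = one V"
  "k < n \<Longrightarrow> Tgt V (Inj V n k) = Num V n"
  using num [of n] unfolding is_coproduct_def by auto

lemma num_copair:
  assumes "x \<in> Obj V" "\<And>i. i < n \<Longrightarrow> v i \<in> hom V (one V) x"
  shows "\<exists>!h. h \<in> hom V (Num V n) x \<and> (\<forall>i < n. h \<odot> Inj V n i = v i)"
proof -
  let ?xs = "replicate n (one V)"
  have "\<forall>z \<in> Obj V. \<forall>f. (\<forall>i < length ?xs. f i \<in> hom V (?xs ! i) z) \<longrightarrow>
      (\<exists>!h. h \<in> hom V (Num V n) z \<and> (\<forall>i < length ?xs. h \<odot> Inj V n i = f i))"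
    using num [of n] unfolding is_coproduct_def by (elim conjE)
  from this [THEN bspec, OF assms(1), THEN spec, of v] assms(2) show ?thesis by simp
qed

lemma num_exists:
  assumes "x \<in> Obj V" "\<And>i. i < n \<Longrightarrow> v i \<in> hom V (one V) x"
  shows "\<exists>h \<in> hom V (Num V n) x. \<forall>i < n. h \<odot> Inj V n i = v i"
  using ex1_implies_ex [OF num_copair [of x n v, OF assms]] by blast

lemma num_ext:
  assumes "h \<in> hom V (Num V n) x" "h' \<in> hom V (Num V n) x"
    and "\<And>i. i < n \<Longrightarrow> h \<odot> Inj V n i = h' \<odot> Inj V n i"
  shows "h = h'"
  by (rule ex1_unique [OF num_copair [of x n "\<lambda>i. h' \<odot> Inj V n i"]]) (use assms in auto)

lemma exponential_ext:
  assumes e: "is_exponential V b c e \<epsilon>" and h: "h \<in> hom V z e" "h' \<in> hom V z e"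
    and b: "b \<in> Obj V" and eq: "\<epsilon> \<odot> pmap V h (Idn V b) = \<epsilon> \<odot> pmap V h' (Idn V b)"
  shows "h = h'"
proof -
  have "\<epsilon> \<in> hom V (prod2 V e b) c" "z \<in> Obj V" using e h by (auto simp: is_exponential_def)
  then have "\<epsilon> \<odot> pmap V h' (Idn V b) \<in> hom V (prod2 V z b) c"
    using h b by (auto simp: pmap_def)
  then have "\<exists>!k. k \<in> hom V z e \<and> \<epsilon> \<odot> pmap V k (Idn V b) = \<epsilon> \<odot> pmap V h' (Idn V b)"
    using e \<open>z \<in> Obj V\<close> unfolding is_exponential_def by blast
  from ex1_unique [OF this, of h h'] h eq show ?thesis by blast
qed

lemma exponential_exists:
  assumes e: "is_exponential V b c e \<epsilon>" and "z \<in> Obj V" "f \<in> hom V (prod2 V z b) c"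
  shows "\<exists>h \<in> hom V z e. \<epsilon> \<odot> pmap V h (Idn V b) = f"
  using assms unfolding is_exponential_def by blast

text \<open>\<open>z \<times> m\<^sub>V\<close> is a coproduct of \<open>m\<close> copies of \<open>z\<close>, because \<open>z \<times> -\<close> has a right adjoint.\<close>

lemma prod_num_exists:
  assumes [simp]: "z \<in> Obj V" "c \<in> Obj V" and f: "\<And>i. i < m \<Longrightarrow> f i \<in> hom V z c"
  shows "\<exists>h \<in> hom V (prod2 V z (Num V m)) c.
    \<forall>i < m. h \<odot> pair V (Idn V z) (Inj V m i \<odot> bang V z) = f i"
proof -
  obtain e \<epsilon> where e: "is_exponential V z c e \<epsilon>" using exponentials [of z c] by auto
  then have [simp]: "e \<in> Obj V" "\<epsilon> \<in> Arr V" "Src V \<epsilon> = prod2 V e z" "Tgt V \<epsilon> = c"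
    by (auto simp: is_exponential_def)
  \<comment> \<open>\<open>v i\<close> is the point of the exponential that names
    \<open>f i\<close>. Naming turns maps out of \<open>z\<close> into points, and points can be
    copaired along \<open>m_V\<close>.\<close>
  have "\<exists>v \<in> hom V (one V) e. \<epsilon> \<odot> pmap V v (Idn V z) = f i \<odot> pr2 V (one V) z" if "i < m" for i
    by (rule exponential_exists [OF e]) (use f [OF that] in auto)
  then obtain v where v: "\<And>i. i < m \<Longrightarrow> v i \<in> hom V (one V) e"
    and ev: "\<And>i. i < m \<Longrightarrow> \<epsilon> \<odot> pmap V (v i) (Idn V z) = f i \<odot> pr2 V (one V) z"
    by metis
  obtain H where H: "H \<in> hom V (Num V m) e" "\<forall>i < m. H \<odot> Inj V m i = v i"
    using num_exists [of e m v] v by auto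
  \<comment> \<open>Uncurrying \<open>H\<close> puts \<open>z\<close> on the right, hence the
    exchanged projections.\<close>
  define h where "h = \<epsilon> \<odot> pair V (H \<odot> pr2 V z (Num V m)) (pr1 V z (Num V m))"
  have "h \<odot> pair V (Idn V z) (Inj V m i \<odot> bang V z) = f i" if i: "i < m" for i
  proof -
    have "h \<odot> pair V (Idn V z) (Inj V m i \<odot> bang V z) =
        \<epsilon> \<odot> pair V ((H \<odot> Inj V m i) \<odot> bang V z) (Idn V z)"
      using H(1) i by (simp add: h_def)
    also have "\<dots> = (\<epsilon> \<odot> pmap V (v i) (Idn V z)) \<odot> pair V (bang V z) (Idn V z)"
      using H(2) v [OF i] i by (simp add: pmap_def)
    also have "\<dots> = f i" unfolding ev [OF i] using f [OF i] by simp
    finally show ?thesis .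
  qed
  moreover have "h \<in> hom V (prod2 V z (Num V m)) c" using H(1) by (simp add: h_def)
  ultimately show ?thesis by blast
qed

text \<open>Currying turns both maps into morphisms out of \<open>m_V\<close>, which
  \<open>num_ext\<close> compares on coprojections. \<open>swap\<close> brings \<open>z\<close> to
  the right, the side from which exponentials transpose.\<close>

lemma prod_num_ext:
  assumes z [simp]: "z \<in> Obj V"
    and h: "h \<in> hom V (prod2 V z (Num V m)) c" "h' \<in> hom V (prod2 V z (Num V m)) c"
    and eq: "\<And>i. i < m \<Longrightarrow> h \<odot> pair V (Idn V z) (Inj V m i \<odot> bang V z) =
      h' \<odot> pair V (Idn V z) (Inj V m i \<odot> bang V z)"
  shows "h = h'"
proof -
  have [simp]: "c \<in> Obj V" using h by auto
  obtain e \<epsilon> where e: "is_exponential V z c e \<epsilon>" using exponentials [of z c] by auto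
  then have [simp]: "e \<in> Obj V" "\<epsilon> \<in> Arr V" "Src V \<epsilon> = prod2 V e z" "Tgt V \<epsilon> = c"
    by (auto simp: is_exponential_def)
  let ?s = "swap V (Num V m) z"
  have s: "?s \<in> hom V (prod2 V (Num V m) z) (prod2 V z (Num V m))" by (simp add: swap_def)
  obtain H where H: "H \<in> hom V (Num V m) e" "\<epsilon> \<odot> pmap V H (Idn V z) = h \<odot> ?s"
    using exponential_exists [OF e, of "Num V m" "h \<odot> ?s"] h(1) s by auto
  obtain H' where H': "H' \<in> hom V (Num V m) e" "\<epsilon> \<odot> pmap V H' (Idn V z) = h' \<odot> ?s"
    using exponential_exists [OF e, of "Num V m" "h' \<odot> ?s"] h(2) s by auto
  have b: "bang V (prod2 V (one V) z) = pr1 V (one V) z" by (rule one_ext) auto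
  \<comment> \<open>Restricting a transpose along a coprojection transposes the restriction to the
    i-th copy of \<open>z\<close>, up to the identification of \<open>1 * z\<close> with
    \<open>z\<close>.\<close>
  have step: "\<epsilon> \<odot> pmap V (K \<odot> Inj V m i) (Idn V z) =
      (k \<odot> pair V (Idn V z) (Inj V m i \<odot> bang V z)) \<odot> pr2 V (one V) z"
    if K: "K \<in> hom V (Num V m) e" "\<epsilon> \<odot> pmap V K (Idn V z) = k \<odot> ?s"
      and k: "k \<in> hom V (prod2 V z (Num V m)) c" and i: "i < m" for k K i
  proof -
    have "\<epsilon> \<odot> pmap V (K \<odot> Inj V m i) (Idn V z) =
        (\<epsilon> \<odot> pmap V K (Idn V z)) \<odot> pmap V (Inj V m i) (Idn V z)"
      using K(1) i by (simp add: pmap_def)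
    also have "\<dots> = (k \<odot> pair V (Idn V z) (Inj V m i \<odot> bang V z)) \<odot> pr2 V (one V) z"
      unfolding K(2) using k i by (simp add: pmap_def swap_def b)
    finally show ?thesis .
  qed
  have "H = H'"
  proof (rule num_ext [OF H(1) H'(1)])
    fix i assume i: "i < m"
    show "H \<odot> Inj V m i = H' \<odot> Inj V m i"
    proof (rule exponential_ext [OF e])
      show "\<epsilon> \<odot> pmap V (H \<odot> Inj V m i) (Idn V z) = \<epsilon> \<odot> pmap V (H' \<odot> Inj V m i) (Idn V z)"
        unfolding step [OF H h(1) i] step [OF H' h(2) i] eq [OF i] ..
    qed (use H(1) H'(1) i in auto)
  qed
  then have "(h \<odot> ?s) \<odot> swap V z (Num V m) = (h' \<odot> ?s) \<odot> swap V z (Num V m)"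
    using H(2) H'(2) by simp
  then show ?thesis using h by (simp add: swap_def)
qed

text \<open>A product of two numerals is a coproduct of points indexed by pairs:
  \<open>num_exists\<close> treats the first index for each fixed second one, then
  \<open>prod_num_exists\<close> treats the second.\<close>

lemma num_num_exists:
  assumes "x \<in> Obj V" "\<And>k i. \<lbrakk>k < a; i < b\<rbrakk> \<Longrightarrow> v k i \<in> hom V (one V) x"
  shows "\<exists>h \<in> hom V (prod2 V (Num V a) (Num V b)) x.
    \<forall>k < a. \<forall>i < b. h \<odot> pair V (Inj V a k) (Inj V b i) = v k i"
proof -
  have "\<exists>f. f \<in> hom V (Num V a) x \<and> (\<forall>k < a. f \<odot> Inj V a k = v k i)" if "i < b" for i
    using num_exists [of x a "\<lambda>k. v k i"] assms that by auto
  then obtain f where f: "\<And>i. i < b \<Longrightarrow> f i \<in> hom V (Num V a) x"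
    and fv: "\<And>i k. \<lbrakk>i < b; k < a\<rbrakk> \<Longrightarrow> f i \<odot> Inj V a k = v k i" by metis
  obtain h where h: "h \<in> hom V (prod2 V (Num V a) (Num V b)) x"
    "\<forall>i < b. h \<odot> pair V (Idn V (Num V a)) (Inj V b i \<odot> bang V (Num V a)) = f i"
    using prod_num_exists [of "Num V a" x b f] assms(1) f by auto
  have "h \<odot> pair V (Inj V a k) (Inj V b i) = v k i" if ki: "k < a" "i < b" for k i
  proof -
    have "h \<odot> pair V (Inj V a k) (Inj V b i) =
        (h \<odot> pair V (Idn V (Num V a)) (Inj V b i \<odot> bang V (Num V a))) \<odot> Inj V a k"
      using h(1) ki by simp
    also have "\<dots> = v k i" using h(2) fv ki by simp
    finally show ?thesis .
  qed
  with h(1) show ?thesis by blast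
qed

lemma num_num_ext:
  assumes h: "h \<in> hom V (prod2 V (Num V a) (Num V b)) x" "h' \<in> hom V (prod2 V (Num V a) (Num V b)) x"
    and eq: "\<And>k i. \<lbrakk>k < a; i < b\<rbrakk> \<Longrightarrow>
      h \<odot> pair V (Inj V a k) (Inj V b i) = h' \<odot> pair V (Inj V a k) (Inj V b i)"
  shows "h = h'"
proof (rule prod_num_ext [OF _ h])
  fix i assume i: "i < b"
  show "h \<odot> pair V (Idn V (Num V a)) (Inj V b i \<odot> bang V (Num V a)) =
      h' \<odot> pair V (Idn V (Num V a)) (Inj V b i \<odot> bang V (Num V a))"
    by (rule num_ext [of _ a x]) (use h eq i in auto)
qed auto

section \<open>Evaluation, digits and powers of numerals\<close>

lemma num_ev_props:
  "num_ev V m n \<in> hom V (prod2 V (Num V (n ^ m)) (Num V m)) (Num V n) \<and>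
    (\<forall>k < n ^ m. \<forall>i < m.
      num_ev V m n \<odot> pair V (Inj V (n ^ m) k) (Inj V m i) = Inj V n (k div n ^ i mod n))"
proof -
  \<comment> \<open>For \<open>n = 0\<close> a digit would be out of range, but then no pair
    \<open>k < n ^ m\<close>, \<open>i < m\<close> exists, because \<open>0 ^ m\<close> is
    \<open>0\<close> unless \<open>m = 0\<close>.\<close>
  have d: "k div n ^ i mod n < n" if "k < n ^ m" "i < m" for k i
    using that by (cases "n = 0") (auto simp: power_0_left)
  have "\<exists>h \<in> hom V (prod2 V (Num V (n ^ m)) (Num V m)) (Num V n).
    \<forall>k < n ^ m. \<forall>i < m. h \<odot> pair V (Inj V (n ^ m) k) (Inj V m i) = Inj V n (k div n ^ i mod n)"
    by (rule num_num_exists) (use d in auto)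
  then have "\<exists>!h. h \<in> hom V (prod2 V (Num V (n ^ m)) (Num V m)) (Num V n) \<and>
    (\<forall>k < n ^ m. \<forall>i < m.
      h \<odot> pair V (Inj V (n ^ m) k) (Inj V m i) = Inj V n (k div n ^ i mod n))"
    using num_num_ext by (elim bexE, intro ex1I) (blast, metis)
  then show ?thesis unfolding num_ev_def by (rule theI')
qed

lemma num_ev_arr [simp]:
  "num_ev V m n \<in> Arr V" "Src V (num_ev V m n) = prod2 V (Num V (n ^ m)) (Num V m)"
  "Tgt V (num_ev V m n) = Num V n"
  using num_ev_props [of m n] by auto

text \<open>The only coprojection of a one-fold copower is inverse to \<open>bang\<close>. This
  serves the case \<open>n ^ 0 = 1\<close> of the powers.\<close>

lemma num_one_terminal:
  assumes "h \<in> hom V z (Num V 1)" "h' \<in> hom V z (Num V 1)"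
  shows "h = h'"
proof -
  have e: "Inj V 1 0 \<odot> bang V (Num V 1) = Idn V (Num V 1)"
    by (rule num_ext [of _ 1 "Num V 1"]) (auto simp: One_nat_def)
  then have "k = Inj V 1 0 \<odot> bang V z" if "k \<in> hom V z (Num V 1)" for k
  proof -
    have "k = (Inj V 1 0 \<odot> bang V (Num V 1)) \<odot> k" using that by (simp add: e)
    then show ?thesis using that by simp
  qed
  with assms show ?thesis by metis
qed

text \<open>Behind this is the bijection of \<open>k < b * a\<close> with the pairs
  \<open>(k mod a, k div a)\<close>. Its inverse \<open>t\<close> can be defined by the values
  \<open>k + a * i\<close> because products distribute over coproducts. \<open>r\<close> and
  \<open>s\<close> are arbitrary so that a given leading-digit map can serve as
  \<open>s\<close>.\<close>

lemma num_mult_product: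
  assumes r: "r \<in> hom V (Num V (b * a)) (Num V a)" "\<And>k. k < b * a \<Longrightarrow> r \<odot> Inj V (b * a) k = Inj V a (k mod a)"
    and s: "s \<in> hom V (Num V (b * a)) (Num V b)" "\<And>k. k < b * a \<Longrightarrow> s \<odot> Inj V (b * a) k = Inj V b (k div a)"
  shows "\<lbrakk>x \<in> hom V z (Num V a); y \<in> hom V z (Num V b)\<rbrakk> \<Longrightarrow>
      \<exists>h \<in> hom V z (Num V (b * a)). r \<odot> h = x \<and> s \<odot> h = y"
    and "\<lbrakk>h \<in> hom V z (Num V (b * a)); h' \<in> hom V z (Num V (b * a)); r \<odot> h = r \<odot> h'; s \<odot> h = s \<odot> h'\<rbrakk>
      \<Longrightarrow> h = h'"
proof -
  have lt: "k + a * i < b * a" if "k < a" "i < b" for k i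
  proof -
    have "k + a * i < a * Suc i" using that by simp
    also have "\<dots> \<le> a * b" using that by (intro mult_le_mono2) simp
    finally show ?thesis by (simp add: mult.commute)
  qed
  have md: "k mod a < a" "k div a < b" if "k < b * a" for k
    using that by (cases "a = 0"; simp add: less_mult_imp_div_less)+
  have "\<exists>t \<in> hom V (prod2 V (Num V a) (Num V b)) (Num V (b * a)).
    \<forall>k < a. \<forall>i < b. t \<odot> pair V (Inj V a k) (Inj V b i) = Inj V (b * a) (k + a * i)"
    by (rule num_num_exists) (use lt in auto)
  then obtain t where t: "t \<in> hom V (prod2 V (Num V a) (Num V b)) (Num V (b * a))"
    and tp: "\<And>k i. \<lbrakk>k < a; i < b\<rbrakk> \<Longrightarrow> t \<odot> pair V (Inj V a k) (Inj V b i) = Inj V (b * a) (k + a * i)"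
    by blast
  have rt: "r \<odot> t = pr1 V (Num V a) (Num V b)"
    by (rule num_num_ext [of _ a b "Num V a"]) (use r t tp lt in simp_all)
  have st: "s \<odot> t = pr2 V (Num V a) (Num V b)"
    by (rule num_num_ext [of _ a b "Num V b"]) (use s t tp lt in simp_all)
  have trs: "t \<odot> pair V r s = Idn V (Num V (b * a))"
  proof (rule num_ext)
    fix k assume k: "k < b * a"
    show "(t \<odot> pair V r s) \<odot> Inj V (b * a) k = Idn V (Num V (b * a)) \<odot> Inj V (b * a) k"
      using k md [OF k] t r(1) s(1) by (simp add: r(2) s(2) tp)
  qed (use t r s in auto)
  {
    assume x: "x \<in> hom V z (Num V a)" and y: "y \<in> hom V z (Num V b)"
    have "(r \<odot> t) \<odot> pair V x y = x" "(s \<odot> t) \<odot> pair V x y = y"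
      unfolding rt st using x y by simp_all
    then show "\<exists>h \<in> hom V z (Num V (b * a)). r \<odot> h = x \<and> s \<odot> h = y"
      using x y t r(1) s(1) by (intro bexI [of _ "t \<odot> pair V x y"]) simp_all
  next
    assume h: "h \<in> hom V z (Num V (b * a))" "h' \<in> hom V z (Num V (b * a))"
      and e: "r \<odot> h = r \<odot> h'" "s \<odot> h = s \<odot> h'"
    have "k = t \<odot> pair V (r \<odot> k) (s \<odot> k)" if "k \<in> hom V z (Num V (b * a))" for k
    proof -
      have "(t \<odot> pair V r s) \<odot> k = k" unfolding trs using that by simp
      then show ?thesis using that t r(1) s(1) by simp
    qed
    with h e show "h = h'" by metis
  }
qed

text \<open>\<open>(n\<^sup>m)\<^sub>V\<close> is the \<open>m\<close>-fold power of \<open>n\<^sub>V\<close>, the projections being the base-\<open>n\<close> digits: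
  \<open>(n\<^bsup>m+1\<^esup>)\<^sub>V \<cong> (n\<^sup>m)\<^sub>V \<times> n\<^sub>V\<close> by splitting off the leading digit.\<close>

lemma num_power_product:
  assumes "\<And>i. i < m \<Longrightarrow> d i \<in> hom V (Num V (n ^ m)) (Num V n)"
    and "\<And>i k. \<lbrakk>i < m; k < n ^ m\<rbrakk> \<Longrightarrow> d i \<odot> Inj V (n ^ m) k = Inj V n (k div n ^ i mod n)"
  shows "is_product V (replicate m (Num V n)) (Num V (n ^ m)) d"
  using assms
proof (induction m arbitrary: d)
  case 0
  show ?case
  proof (rule is_productI)
    fix z f assume "z \<in> Obj V"
    then show "\<exists>h \<in> hom V z (Num V (n ^ 0)). \<forall>i < length (replicate 0 (Num V n)). d i \<odot> h = f i"
      by (intro bexI [of _ "Inj V 1 0 \<odot> bang V z"]) (auto simp: One_nat_def)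
  next
    fix z h h' assume "h \<in> hom V z (Num V (n ^ 0))" "h' \<in> hom V z (Num V (n ^ 0))"
    then show "h = h'" by (intro num_one_terminal) simp_all
  qed auto
next
  case (Suc m)
  note d = Suc.prems(1) and dk = Suc.prems(2)
  let ?a = "n ^ m"
  have pos: "0 < ?a" "0 < n" if "k < n * ?a" for k using that by (cases "n = 0"; auto)+
  \<comment> \<open>\<open>r\<close> forgets the leading digit and \<open>d m\<close> extracts it;
    the \<open>mod n\<close> in \<open>d m\<close> changes nothing, since
    \<open>k div n ^ m < n\<close>.\<close>
  have "\<exists>r \<in> hom V (Num V (n * ?a)) (Num V ?a). \<forall>k < n * ?a. r \<odot> Inj V (n * ?a) k = Inj V ?a (k mod ?a)"
    by (rule num_exists) (use pos in auto)
  then obtain r where r: "r \<in> hom V (Num V (n * ?a)) (Num V ?a)"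
    "\<And>k. k < n * ?a \<Longrightarrow> r \<odot> Inj V (n * ?a) k = Inj V ?a (k mod ?a)" by blast
  have s: "d m \<in> hom V (Num V (n * ?a)) (Num V n)"
    "\<And>k. k < n * ?a \<Longrightarrow> d m \<odot> Inj V (n * ?a) k = Inj V n (k div ?a)"
    using d [of m] dk [of m] by (simp_all add: less_mult_imp_div_less)
  \<comment> \<open>The induction hypothesis asks for digit maps on the shorter numbers. They are
    built here, and \<open>cr\<close> relates them to the given \<open>d i\<close>.\<close>
  have "\<exists>c. c \<in> hom V (Num V ?a) (Num V n) \<and> (\<forall>k < ?a. c \<odot> Inj V ?a k = Inj V n (k div n ^ i mod n))"
    if "i < m" for i
  proof -
    have "0 < n" if "k < ?a" for k using that \<open>i < m\<close> by (cases "n = 0") (auto simp: power_0_left)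
    then show ?thesis
      using num_exists [of "Num V n" ?a "\<lambda>k. Inj V n (k div n ^ i mod n)"] by auto
  qed
  then obtain c where c: "\<And>i. i < m \<Longrightarrow> c i \<in> hom V (Num V ?a) (Num V n)"
    and ck: "\<And>i k. \<lbrakk>i < m; k < ?a\<rbrakk> \<Longrightarrow> c i \<odot> Inj V ?a k = Inj V n (k div n ^ i mod n)" by metis
  have IH: "is_product V (replicate m (Num V n)) (Num V ?a) c" by (rule Suc.IH [OF c ck])
  \<comment> \<open>The digit at position \<open>i < m\<close> survives the reduction because
    \<open>n ^ (i + 1)\<close> divides \<open>n ^ m\<close>.\<close>
  have digit: "k mod ?a div n ^ i mod n = k div n ^ i mod n" if "i < m" for i k
  proof -
    obtain j where j: "m = i + Suc j" using \<open>i < m\<close> less_iff_Suc_add by auto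
    then have a: "?a = n ^ i * (n * n ^ j)" by (simp add: power_add)
    show ?thesis
    proof (cases "n = 0")
      case False
      have "k mod ?a div n ^ i = k div n ^ i mod (n * n ^ j)"
        unfolding a using False by (simp add: mod_mult2_eq)
      then show ?thesis by (simp add: mod_mod_cancel)
    qed (use that in \<open>simp add: power_0_left\<close>)
  qed
  have cr: "c i \<odot> r = d i" if i: "i < m" for i
  proof (rule num_ext)
    fix k assume k: "k < n ^ Suc m"
    then show "(c i \<odot> r) \<odot> Inj V (n ^ Suc m) k = d i \<odot> Inj V (n ^ Suc m) k"
      using r(1) c [OF i] ck [OF i, of "k mod ?a"] dk [of i k] i pos [of k] by (simp add: r(2) digit)
  qed (use r(1) c [OF i] d [of i] i in auto)
  show ?case
  proof (rule is_productI)
    fix z f assume z: "z \<in> Obj V"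
      and f: "\<And>i. i < length (replicate (Suc m) (Num V n)) \<Longrightarrow> f i \<in> hom V z (replicate (Suc m) (Num V n) ! i)"
    have f': "f i \<in> hom V z (Num V n)" if "i < Suc m" for i using f [of i] that by (simp del: replicate_Suc)
    obtain x where x: "x \<in> hom V z (Num V ?a)" "\<forall>i < m. c i \<odot> x = f i"
      using is_product_exists [OF IH z, of f] f' by auto
    obtain h where h: "h \<in> hom V z (Num V (n * ?a))" "r \<odot> h = x" "d m \<odot> h = f m"
      using num_mult_product(1) [OF r s x(1) f' [of m]] by auto
    have "d i \<odot> h = f i" if "i < Suc m" for i
    proof (cases "i = m")
      case False
      with that have i: "i < m" by simp
      have "d i \<odot> h = c i \<odot> r \<odot> h" unfolding cr [OF i, symmetric] using c [OF i] r(1) h(1) by simp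
      then show ?thesis using x(2) h(2) i by simp
    qed (use h in simp)
    with h(1) show "\<exists>h \<in> hom V z (Num V (n ^ Suc m)). \<forall>i < length (replicate (Suc m) (Num V n)). d i \<odot> h = f i"
      by auto
  next
    fix z h h' assume h: "h \<in> hom V z (Num V (n ^ Suc m))" "h' \<in> hom V z (Num V (n ^ Suc m))"
      and e: "\<And>i. i < length (replicate (Suc m) (Num V n)) \<Longrightarrow> d i \<odot> h = d i \<odot> h'"
    show "h = h'"
    proof (rule num_mult_product(2) [OF r s])
      show "r \<odot> h = r \<odot> h'"
      proof (rule is_product_ext [OF IH])
        fix i assume "i < length (replicate m (Num V n))"
        then have i: "i < m" by simp
        have "c i \<odot> r \<odot> k = d i \<odot> k" if "k \<in> hom V z (Num V (n ^ Suc m))" for k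
          unfolding cr [OF i, symmetric] using c [OF i] r(1) that by simp
        then show "c i \<odot> r \<odot> h = c i \<odot> r \<odot> h'" using h e [of i] i by simp
      qed (use h r in auto)
    qed (use h e [of m] in auto)
  qed (use d in \<open>simp_all del: replicate_Suc power_Suc\<close>)
qed

end

text \<open>A morphism into \<open>(n\<^sup>m)\<^sub>V\<close> is a generalized function from \<open>m\<close> to \<open>n\<close>;
  \<open>app\<close> applies it to a generalized element of \<open>m\<^sub>V\<close>.\<close>

definition app :: "('o, 'a, 'r) num_cat_scheme \<Rightarrow> nat \<Rightarrow> nat \<Rightarrow> 'a \<Rightarrow> 'a \<Rightarrow> 'a" where
  "app V m n g x = num_ev V m n \<odot>\<^bsub>V\<^esub> pair V g x"

lemma arity_ecat_simps [simp]:
  "eobj (arity_ecat V) = UNIV"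
  "ehom (arity_ecat V) a b = Num V (a ^ b)"
  by (simp_all add: arity_ecat_def eop_def num_ecat_def)

section \<open>The arity category through application to points\<close>

context num_ccc begin

lemma app_arr [simp]:
  assumes "g \<in> Arr V" "x \<in> Arr V" "Src V x = Src V g" "Tgt V g = Num V (n ^ m)" "Tgt V x = Num V m"
  shows "app V m n g x \<in> Arr V" "Src V (app V m n g x) = Src V g" "Tgt V (app V m n g x) = Num V n"
  using assms by (simp_all add: app_def)

lemma app_cmp [simp]:
  assumes "g \<in> Arr V" "x \<in> Arr V" "Src V x = Src V g" "Tgt V g = Num V (n ^ m)" "Tgt V x = Num V m"
    "t \<in> Arr V" "Tgt V t = Src V g"
  shows "app V m n g x \<odot> t = app V m n (g \<odot> t) (x \<odot> t)"
  using assms by (simp add: app_def)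

text \<open>\<open>num_ev\<close> at the i-th coprojection extracts the i-th digit, so
  \<open>num_power_product\<close> applies. A morphism into \<open>(n^m)_V\<close> thus amounts to
  its \<open>m\<close> values at the points of \<open>m_V\<close>.\<close>

lemma digits_product:
  "is_product V (replicate m (Num V n)) (Num V (n ^ m))
    (\<lambda>i. app V m n (Idn V (Num V (n ^ m))) (Inj V m i \<odot> bang V (Num V (n ^ m))))"
proof (rule num_power_product)
  fix i k assume "i < m" "k < n ^ m"
  then show "app V m n (Idn V (Num V (n ^ m))) (Inj V m i \<odot> bang V (Num V (n ^ m))) \<odot> Inj V (n ^ m) k =
      Inj V n (k div n ^ i mod n)"
    using num_ev_props [of m n] by (simp add: app_def)
qed simp

lemma app_exists:
  assumes "z \<in> Obj V" "\<And>i. i < m \<Longrightarrow> f i \<in> hom V z (Num V n)"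
  shows "\<exists>g \<in> hom V z (Num V (n ^ m)). \<forall>i < m. app V m n g (Inj V m i \<odot> bang V z) = f i"
proof -
  obtain g where "g \<in> hom V z (Num V (n ^ m))"
    "\<forall>i < m. app V m n (Idn V (Num V (n ^ m))) (Inj V m i \<odot> bang V (Num V (n ^ m))) \<odot> g = f i"
    using is_product_exists [OF digits_product [of m n] assms(1), of f] assms(2) by auto
  then show ?thesis by (intro bexI [of _ g]) auto
qed

lemma app_ext:
  assumes g: "g \<in> hom V z (Num V (n ^ m))" "g' \<in> hom V z (Num V (n ^ m))"
    and eq: "\<And>i. i < m \<Longrightarrow>
      app V m n g (Inj V m i \<odot> bang V z) = app V m n g' (Inj V m i \<odot> bang V z)"
  shows "g = g'"
  by (rule is_product_ext [OF digits_product [of m n] g]) (use g eq in auto)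

text \<open>Maps out of \<open>z * m_V\<close> (by \<open>prod_num_ext\<close>) and maps into
  \<open>(n^m)_V\<close> (by \<open>app_ext\<close>) are both determined by \<open>m\<close> values
  at points. Hence \<open>num_ev\<close> is the evaluation of an exponential, and the description in
  \<open>transpose\<close> is proper.\<close>

lemma transpose_props:
  assumes z [simp]: "z \<in> Obj V" and f: "f \<in> hom V (prod2 V z (Num V m)) (Num V n)"
  defines "g \<equiv> transpose V z (Num V m) (Num V (n ^ m)) (num_ev V m n) f"
  shows "g \<in> hom V z (Num V (n ^ m)) \<and> num_ev V m n \<odot> pmap V g (Idn V (Num V m)) = f"
proof -
  let ?pt = "\<lambda>i. Inj V m i \<odot> bang V z"
  have pt: "app V m n g (?pt i) = (num_ev V m n \<odot> pmap V g (Idn V (Num V m))) \<odot> pair V (Idn V z) (?pt i)"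
    if "i < m" "g \<in> hom V z (Num V (n ^ m))" for g i
    using that by (simp add: app_def pmap_def)
  have "\<exists>g \<in> hom V z (Num V (n ^ m)). \<forall>i < m. app V m n g (?pt i) = f \<odot> pair V (Idn V z) (?pt i)"
    by (rule app_exists) (use f in auto)
  then obtain g0 where g0: "g0 \<in> hom V z (Num V (n ^ m))"
    "\<forall>i < m. app V m n g0 (?pt i) = f \<odot> pair V (Idn V z) (?pt i)" by blast
  have "num_ev V m n \<odot> pmap V g0 (Idn V (Num V m)) = f"
  proof (rule prod_num_ext [OF z _ f])
    fix i assume i: "i < m"
    show "(num_ev V m n \<odot> pmap V g0 (Idn V (Num V m))) \<odot> pair V (Idn V z) (?pt i) =
        f \<odot> pair V (Idn V z) (?pt i)"
      using pt [OF i g0(1)] g0(2) i by simp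
  qed (use g0 in \<open>auto simp: pmap_def\<close>)
  moreover have "h = h'" if "h \<in> hom V z (Num V (n ^ m))" "h' \<in> hom V z (Num V (n ^ m))"
    "num_ev V m n \<odot> pmap V h (Idn V (Num V m)) = f"
    "num_ev V m n \<odot> pmap V h' (Idn V (Num V m)) = f" for h h'
    by (rule app_ext [OF that(1,2)]) (simp add: pt that(1,2) del: hom_def, simp add: that(3,4))
  ultimately have "\<exists>!g. g \<in> hom V z (Num V (n ^ m)) \<and> num_ev V m n \<odot> pmap V g (Idn V (Num V m)) = f"
    using g0(1) by blast
  then show ?thesis unfolding g_def transpose_def by (rule theI')
qed

text \<open>The beta rule at an arbitrary stage \<open>y\<close>; it computes the identities and the
  composition of the arity category.\<close>

lemma app_transpose:
  assumes z: "z \<in> Obj V" and f: "f \<in> hom V (prod2 V z (Num V m)) (Num V n)"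
    and t: "t \<in> hom V y z" and x: "x \<in> hom V y (Num V m)"
  shows "app V m n (transpose V z (Num V m) (Num V (n ^ m)) (num_ev V m n) f \<odot> t) x = f \<odot> pair V t x"
    (is "app V m n (?g \<odot> t) x = _")
proof -
  note g = transpose_props [OF z f]
  have "f \<odot> pair V t x = (num_ev V m n \<odot> pmap V ?g (Idn V (Num V m))) \<odot> pair V t x" using g by simp
  also have "\<dots> = app V m n (?g \<odot> t) x"
    using conjunct1 [OF g] z t x by (simp add: app_def pmap_def)
  finally show ?thesis by simp
qed

lemma arity_eid:
  "eid (arity_ecat V) m \<in> hom V (one V) (Num V (m ^ m))"
  using transpose_props [of "one V" "pr2 V (one V) (Num V m)" m m]
  by (simp add: arity_ecat_def eop_def num_ecat_def)

lemma app_arity_eid: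
  assumes "x \<in> Arr V" "Src V x = z" "Tgt V x = Num V m"
  shows "app V m m (eid (arity_ecat V) m \<odot> bang V z) x = x"
  using app_transpose [of "one V" "pr2 V (one V) (Num V m)" m m "bang V z" z x] assms
  by (auto simp add: arity_ecat_def eop_def num_ecat_def)

lemma arity_ecmp_eq:
  "ecmp (arity_ecat V) a b c =
    transpose V (prod2 V (Num V (a ^ b)) (Num V (b ^ c))) (Num V c) (Num V (a ^ c)) (num_ev V c a)
      (num_ev V b a \<odot> pmap V (Idn V (Num V (a ^ b))) (num_ev V c b)
        \<odot> assoc V (Num V (a ^ b)) (Num V (b ^ c)) (Num V c))
    \<odot> swap V (Num V (b ^ c)) (Num V (a ^ b))"
  by (simp add: arity_ecat_def eop_def num_ecat_def)

lemma arity_ecmp_body: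
  "num_ev V b a \<odot> pmap V (Idn V (Num V (a ^ b))) (num_ev V c b)
      \<odot> assoc V (Num V (a ^ b)) (Num V (b ^ c)) (Num V c)
    \<in> hom V (prod2 V (prod2 V (Num V (a ^ b)) (Num V (b ^ c))) (Num V c)) (Num V a)"
  by (simp add: pmap_def assoc_def)

lemma arity_ecmp:
  "ecmp (arity_ecat V) a b c \<in> hom V (prod2 V (Num V (b ^ c)) (Num V (a ^ b))) (Num V (a ^ c))"
  using transpose_props [OF _ arity_ecmp_body [of b a c]]
  by (simp add: arity_ecmp_eq swap_def)

text \<open>In the opposite category the arrows from \<open>a\<close> to \<open>b\<close> are
  functions from \<open>b\<close> to \<open>a\<close>, so the later arrow \<open>g\<close> acts
  first.\<close>

lemma app_arity_gcmp:
  assumes f: "f \<in> hom V z (Num V (a ^ b))" and g: "g \<in> hom V z (Num V (b ^ c))"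
    and x: "x \<in> hom V z (Num V c)"
  shows "app V c a (gcmp V (arity_ecat V) a b c g f) x = app V b a f (app V c b g x)"
proof -
  let ?z = "prod2 V (Num V (a ^ b)) (Num V (b ^ c))"
  let ?t = "transpose V ?z (Num V c) (Num V (a ^ c)) (num_ev V c a)
      (num_ev V b a \<odot> pmap V (Idn V (Num V (a ^ b))) (num_ev V c b)
        \<odot> assoc V (Num V (a ^ b)) (Num V (b ^ c)) (Num V c))"
  have t: "?t \<in> hom V ?z (Num V (a ^ c))"
    using transpose_props [OF _ arity_ecmp_body [of b a c]] by simp
  then have e: "gcmp V (arity_ecat V) a b c g f = ?t \<odot> pair V f g"
    using f g by (simp add: gcmp_def arity_ecmp_eq swap_def)
  have "app V c a (gcmp V (arity_ecat V) a b c g f) x = (num_ev V b a \<odot> pmap V (Idn V (Num V (a ^ b))) (num_ev V c b)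
        \<odot> assoc V (Num V (a ^ b)) (Num V (b ^ c)) (Num V c)) \<odot> pair V (pair V f g) x"
    unfolding e by (rule app_transpose [OF _ arity_ecmp_body]) (use f g x in auto)
  also have "\<dots> = app V b a f (app V c b g x)"
    using f g x by (simp add: app_def pmap_def assoc_def)
  finally show ?thesis .
qed

lemma arity_gcmp_arr [simp]:
  assumes "f \<in> Arr V" "g \<in> Arr V" "Src V g = Src V f" "Tgt V f = Num V (a ^ b)" "Tgt V g = Num V (b ^ c)"
  shows "gcmp V (arity_ecat V) a b c g f \<in> Arr V"
    "Src V (gcmp V (arity_ecat V) a b c g f) = Src V f"
    "Tgt V (gcmp V (arity_ecat V) a b c g f) = Num V (a ^ c)"
  using assms arity_ecmp [of a b c] by (simp_all add: gcmp_def)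

text \<open>By \<open>app_ext\<close> elements agree if they act equally on points, where both
  bracketings become the same iterated application.\<close>

lemma arity_enriched_category: "enriched_category V (arity_ecat V)"
proof (rule enriched_categoryI; (unfold arity_ecat_simps)?)
  fix a b c d :: nat and z f g h
  assume z: "z \<in> Obj V" and f: "f \<in> hom V z (Num V (a ^ b))"
    and g: "g \<in> hom V z (Num V (b ^ c))" and h: "h \<in> hom V z (Num V (c ^ d))"
  let ?g = "gcmp V (arity_ecat V)"
  show "?g a b d (?g b c d h g) f = ?g a c d h (?g a b c g f)"
    by (rule app_ext [of _ z a d]) (use z f g h in \<open>auto simp: app_arity_gcmp [where z = z]\<close>)
next
  fix a b :: nat and z f
  assume z: "z \<in> Obj V" and f: "f \<in> hom V z (Num V (a ^ b))"
  let ?g = "gcmp V (arity_ecat V)"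
  have e: "eid (arity_ecat V) n \<in> Arr V" "Src V (eid (arity_ecat V) n) = one V"
    "Tgt V (eid (arity_ecat V) n) = Num V (n ^ n)" for n
    using arity_eid [of n] by auto
  show "?g a b b (eid (arity_ecat V) b \<odot> bang V z) f = f"
    by (rule app_ext [of _ z a b]) (use z f e in \<open>auto simp: app_arity_gcmp [where z = z] app_arity_eid\<close>)
  show "?g a a b f (eid (arity_ecat V) a \<odot> bang V z) = f"
    by (rule app_ext [of _ z a b]) (use z f e in \<open>auto simp: app_arity_gcmp [where z = z] app_arity_eid\<close>)
qed (use arity_eid arity_ecmp in auto)

text \<open>The product of \<open>bs\<close> in the arity category is the sum of the numbers \<open>bs\<close>; its legs are given by
  any enumeration \<open>\<phi>\<close> of the disjoint union of the sets \<open>{..< bs ! i}\<close>.\<close>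

lemma arity_eproduct_exists: "\<exists>b q. is_eproduct V (arity_ecat V) b bs q"
proof -
  interpret A: enriched_over_ccc V "arity_ecat V"
    by (intro enriched_over_ccc.intro num_ccc_axioms arity_enriched_category)
  define S where "S = Sigma {..<length bs} (\<lambda>i. {..<bs ! i})"
  define n where "n = card S"
  have "finite S" by (simp add: S_def)
  then obtain \<phi> where \<phi>: "bij_betw \<phi> S {..<n}"
    using ex_bij_betw_finite_nat [of S] by (auto simp: n_def lessThan_atLeast0)
  define \<psi> where "\<psi> = inv_into S \<phi>"
  have S: "(i, j) \<in> S \<longleftrightarrow> i < length bs \<and> j < bs ! i" for i j by (auto simp: S_def)
  have \<phi>_lt: "\<phi> (i, j) < n" and \<psi>_\<phi>: "\<psi> (\<phi> (i, j)) = (i, j)" if "i < length bs" "j < bs ! i" for i j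
    using that \<phi> S [of i j] by (auto simp: \<psi>_def bij_betw_def)
  have \<psi>: "\<psi> l \<in> S" "\<phi> (\<psi> l) = l" if "l < n" for l
    using that \<phi> by (auto simp: \<psi>_def bij_betw_def inv_into_into f_inv_into_f)
  \<comment> \<open>\<open>q i\<close> names the injection of the i-th summand, \<open>j\<close>
    going to \<open>\<phi> (i, j)\<close>; in the opposite category this is a projection.\<close>
  have "\<exists>q \<in> hom V (one V) (Num V (n ^ (bs ! i))).
      \<forall>j < bs ! i. app V (bs ! i) n q (Inj V (bs ! i) j \<odot> bang V (one V)) = Inj V n (\<phi> (i, j))"
    if "i < length bs" for i
    by (rule app_exists) (use \<phi>_lt that in auto)
  then obtain q where q: "\<And>i. i < length bs \<Longrightarrow> q i \<in> hom V (one V) (Num V (n ^ (bs ! i)))"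
    and app_q: "\<And>i j. \<lbrakk>i < length bs; j < bs ! i\<rbrakk> \<Longrightarrow>
      app V (bs ! i) n (q i) (Inj V (bs ! i) j) = Inj V n (\<phi> (i, j))"
    by (simp del: hom_def) metis
  \<comment> \<open>Composing with the leg \<open>q i\<close> reindexes \<open>u\<close> along
    \<open>\<phi> (i, -)\<close>, so the legs together see every value of \<open>u\<close>.\<close>
  have leg: "app V (bs ! i) c (gcmp V (arity_ecat V) c n (bs ! i) (q i \<odot> bang V z) u)
      (Inj V (bs ! i) j \<odot> bang V z) = app V n c u (Inj V n (\<phi> (i, j)) \<odot> bang V z)"
    if "z \<in> Obj V" "u \<in> hom V z (Num V (c ^ n))" "i < length bs" "j < bs ! i" for z c u i j
    using that q [OF that(3)] app_q [OF that(3,4), symmetric]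
    by (simp add: app_arity_gcmp [where z = z])
  have "is_eproduct V (arity_ecat V) n bs q"
  proof (rule A.is_eproductI; (unfold arity_ecat_simps)?)
    fix c z f assume z: "z \<in> Obj V" and f: "\<And>i. i < length bs \<Longrightarrow> f i \<in> hom V z (Num V (c ^ (bs ! i)))"
    \<comment> \<open>The value wanted at \<open>l\<close> is the one that \<open>f\<close>
      prescribes at the summand and position decoded by \<open>\<psi> l\<close>.\<close>
    define g where "g l = (case \<psi> l of (i, j) \<Rightarrow> app V (bs ! i) c (f i) (Inj V (bs ! i) j \<odot> bang V z))" for l
    have "\<exists>u \<in> hom V z (Num V (c ^ n)). \<forall>l < n. app V n c u (Inj V n l \<odot> bang V z) = g l"
    proof (rule app_exists [OF z])
      fix l assume "l < n"
      then have "\<psi> l \<in> S" by (rule \<psi>)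
      then show "g l \<in> hom V z (Num V c)" using f z by (auto simp: g_def S split: prod.split)
    qed
    then obtain u where u: "u \<in> hom V z (Num V (c ^ n))"
      "\<forall>l < n. app V n c u (Inj V n l \<odot> bang V z) = g l" by blast
    have "gcmp V (arity_ecat V) c n (bs ! i) (q i \<odot> bang V z) u = f i" if i: "i < length bs" for i
    proof (rule app_ext [OF _ f [OF i]])
      fix j assume j: "j < bs ! i"
      show "app V (bs ! i) c (gcmp V (arity_ecat V) c n (bs ! i) (q i \<odot> bang V z) u)
          (Inj V (bs ! i) j \<odot> bang V z) = app V (bs ! i) c (f i) (Inj V (bs ! i) j \<odot> bang V z)"
        using leg [OF z u(1) i j] u(2) \<phi>_lt [OF i j] \<psi>_\<phi> [OF i j] by (simp add: g_def)
    qed (use u(1) q [OF i] z in auto)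
    with u(1) show "\<exists>u \<in> hom V z (Num V (c ^ n)). \<forall>i < length bs.
        gcmp V (arity_ecat V) c n (bs ! i) (q i \<odot> bang V z) u = f i" by blast
  next
    fix c z u u'
    assume z: "z \<in> Obj V" and u: "u \<in> hom V z (Num V (c ^ n))" "u' \<in> hom V z (Num V (c ^ n))"
      and e: "\<And>i. i < length bs \<Longrightarrow> gcmp V (arity_ecat V) c n (bs ! i) (q i \<odot> bang V z) u =
        gcmp V (arity_ecat V) c n (bs ! i) (q i \<odot> bang V z) u'"
    show "u = u'"
    proof (rule app_ext [OF u])
      fix l assume l: "l < n"
      obtain i j where ij: "\<psi> l = (i, j)" by (cases "\<psi> l")
      with \<psi> [OF l] have "i < length bs" "j < bs ! i" "\<phi> (i, j) = l" using S by auto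
      then show "app V n c u (Inj V n l \<odot> bang V z) = app V n c u' (Inj V n l \<odot> bang V z)"
        using leg [OF z u(1), of i j] leg [OF z u(2), of i j] e [of i] by simp
    qed
  qed (use q in auto)
  then show ?thesis by blast
qed

end

section \<open>Compatibility of \<open>F\<close> with the arity categories\<close>

locale arity_base_change = cartesian_base_change +
  assumes num: "preserves_num V W F"
begin

lemma F_num [simp]: "ob F (Num V n) = Num W n"
  using num by (simp add: preserves_num_def)

lemma F_inj: "i < n \<Longrightarrow> ar F (Inj V n i) \<odot>\<^bsub>W\<^esub> cmp [] = Inj W n i"
  using num by (simp add: preserves_num_def)

text \<open>Both sides are maps out of a product of numerals in W, hence comparable on pairs of
  coprojections. There \<open>F_inj\<close> is decisive: \<open>F\<close> keeps the coprojections
  and with them the digits.\<close>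

lemma F_num_ev: "ar F (num_ev V m n) \<odot>\<^bsub>W\<^esub> cmp [Num V (n ^ m), Num V m] = num_ev W m n"
proof (rule W.num_num_ext)
  fix k i assume k: "k < n ^ m" and i: "i < m"
  have d: "k div n ^ i mod n < n" using k i by (cases "n = 0") (auto simp: power_0_left)
  have "(ar F (num_ev V m n) \<odot>\<^bsub>W\<^esub> cmp [Num V (n ^ m), Num V m]) \<odot>\<^bsub>W\<^esub> pair W (Inj W (n ^ m) k) (Inj W m i) =
      ar F (num_ev V m n \<odot>\<^bsub>V\<^esub> pair V (Inj V (n ^ m) k) (Inj V m i)) \<odot>\<^bsub>W\<^esub> cmp []"
    unfolding F_inj [OF k, symmetric] F_inj [OF i, symmetric] using k i by simp
  also have "\<dots> = Inj W n (k div n ^ i mod n)"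
    using V.num_ev_props [of m n] k i by (simp add: F_inj d)
  finally show "(ar F (num_ev V m n) \<odot>\<^bsub>W\<^esub> cmp [Num V (n ^ m), Num V m]) \<odot>\<^bsub>W\<^esub>
      pair W (Inj W (n ^ m) k) (Inj W m i) = num_ev W m n \<odot>\<^bsub>W\<^esub> pair W (Inj W (n ^ m) k) (Inj W m i)"
    using W.num_ev_props [of m n] k i by simp
qed simp_all

lemma F_app:
  assumes "g \<in> hom V z (Num V (n ^ m))" "x \<in> hom V z (Num V m)"
  shows "ar F (app V m n g x) = app W m n (ar F g) (ar F x)"
  using assms by (simp add: app_def F_num_ev [symmetric])

lemma F_point:
  assumes "z \<in> Obj V" "i < m"
  shows "ar F (Inj V m i \<odot>\<^bsub>V\<^esub> bang V z) = Inj W m i \<odot>\<^bsub>W\<^esub> bang W (ob F z)"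
  using assms by (simp add: F_inj [symmetric])

text \<open>Under \<open>app_ext\<close> each structure map only has to act correctly on points, and
  \<open>F_app\<close> and \<open>F_point\<close> carry this action over from V.\<close>

lemma base_change_arity: "base_change V W F (arity_ecat V) = arity_ecat W"
proof -
  let ?A = "arity_ecat V" let ?B = "arity_ecat W"
  have id: "ar F (eid ?A m) \<odot>\<^bsub>W\<^esub> cmp [] = eid ?B m" for m
  proof (rule W.app_ext [of _ "one W" m m])
    fix i assume i: "i < m"
    have e: "eid ?A m \<in> Arr V" "Src V (eid ?A m) = one V" "Tgt V (eid ?A m) = Num V (m ^ m)"
      "eid ?B m \<in> Arr W" "Src W (eid ?B m) = one W"
      using V.arity_eid [of m] W.arity_eid [of m] by auto
    have "app W m m (ar F (eid ?A m) \<odot>\<^bsub>W\<^esub> cmp []) (Inj W m i) = ar F (app V m m (eid ?A m) (Inj V m i)) \<odot>\<^bsub>W\<^esub> cmp []"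
      using e i by (simp add: F_app [where z = "one V"] F_inj)
    also have "app V m m (eid ?A m) (Inj V m i) = Inj V m i"
      using V.app_arity_eid [of "Inj V m i" "one V" m] e i by simp
    finally have "app W m m (ar F (eid ?A m) \<odot>\<^bsub>W\<^esub> cmp []) (Inj W m i) = Inj W m i"
      using i by (simp add: F_inj)
    moreover have "app W m m (eid ?B m) (Inj W m i) = Inj W m i"
      using W.app_arity_eid [of "Inj W m i" "one W" m] e i by simp
    ultimately show "app W m m (ar F (eid ?A m) \<odot>\<^bsub>W\<^esub> cmp []) (Inj W m i \<odot>\<^bsub>W\<^esub> bang W (one W)) =
      app W m m (eid ?B m) (Inj W m i \<odot>\<^bsub>W\<^esub> bang W (one W))" using i by simp
  qed (use V.arity_eid [of m] W.arity_eid [of m] in auto)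
  have cmp: "ar F (ecmp ?A a b c) \<odot>\<^bsub>W\<^esub> cmp [Num V (b ^ c), Num V (a ^ b)] = ecmp ?B a b c" for a b c
  proof -
    let ?xs = "[Num V (b ^ c), Num V (a ^ b)]" let ?ys = "[Num W (b ^ c), Num W (a ^ b)]"
    let ?P = "Prd V ?xs" let ?Q = "Prd W ?ys"
    have pr: "ar F (Prj V ?xs 0) \<odot>\<^bsub>W\<^esub> cmp ?xs = Prj W ?ys 0" "ar F (Prj V ?xs 1) \<odot>\<^bsub>W\<^esub> cmp ?xs = Prj W ?ys 1"
      using cmp_props [of ?xs] unfolding V.all_less_two by auto
    have e: "ecmp ?A a b c \<in> hom V ?P (Num V (a ^ c))" "ecmp ?B a b c \<in> hom W ?Q (Num W (a ^ c))"
      by (rule V.arity_ecmp W.arity_ecmp)+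
    \<comment> \<open>Composition is itself the composite of the universal pair of composable
      elements, the projections, so \<open>app_arity_gcmp\<close> gives its action.\<close>
    have g: "ecmp ?A a b c = gcmp V ?A a b c (Prj V ?xs 0) (Prj V ?xs 1)"
      "ecmp ?B a b c = gcmp W ?B a b c (Prj W ?ys 0) (Prj W ?ys 1)"
      using e by (simp_all add: gcmp_def)
    show ?thesis
    proof (rule W.app_ext [of _ ?Q a c])
      fix i assume i: "i < c"
      let ?p = "Inj V c i \<odot>\<^bsub>V\<^esub> bang V ?P"
      have p: "?p \<in> hom V ?P (Num V c)" using i by simp
      have "Inj W c i \<odot>\<^bsub>W\<^esub> bang W ?Q = ar F ?p \<odot>\<^bsub>W\<^esub> cmp ?xs"
        using i by (simp add: F_inj [symmetric])
      then have "app W c a (ar F (ecmp ?A a b c) \<odot>\<^bsub>W\<^esub> cmp ?xs) (Inj W c i \<odot>\<^bsub>W\<^esub> bang W ?Q) =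
          ar F (app V c a (ecmp ?A a b c) ?p) \<odot>\<^bsub>W\<^esub> cmp ?xs"
        using e p by (simp add: F_app [where z = ?P] del: F_cmp)
      also have "app V c a (ecmp ?A a b c) ?p = app V b a (Prj V ?xs 1) (app V c b (Prj V ?xs 0) ?p)"
        unfolding g by (rule V.app_arity_gcmp) (use p in auto)
      also have "ar F \<dots> \<odot>\<^bsub>W\<^esub> cmp ?xs =
          app W b a (Prj W ?ys 1) (app W c b (Prj W ?ys 0) (Inj W c i \<odot>\<^bsub>W\<^esub> bang W ?Q))"
        using p i by (simp add: F_app [where z = ?P] F_point pr del: F_cmp)
      also have "\<dots> = app W c a (ecmp ?B a b c) (Inj W c i \<odot>\<^bsub>W\<^esub> bang W ?Q)"
        unfolding g by (rule W.app_arity_gcmp [symmetric]) (use i in auto)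
      finally show "app W c a (ar F (ecmp ?A a b c) \<odot>\<^bsub>W\<^esub> cmp ?xs) (Inj W c i \<odot>\<^bsub>W\<^esub> bang W ?Q) =
          app W c a (ecmp ?B a b c) (Inj W c i \<odot>\<^bsub>W\<^esub> bang W ?Q)" .
    qed (use e in auto)
  qed
  show ?thesis
    by (rule ecat.equality) (auto simp: fun_eq_iff id cmp)
qed

lemma base_change_theory_eq:
  assumes "enriched_functor V (arity_ecat V) T \<tau>"
  shows "base_change_theory W F \<tau> = base_change_fun F \<tau>"
proof -
  interpret \<tau>: enriched_functor V "arity_ecat V" T \<tau> by fact
  have "ar F (fhom \<tau> m n) \<odot>\<^bsub>W\<^esub> Idn W (Num W (m ^ n)) = ar F (fhom \<tau> m n)" for m n
    using \<tau>.fhom_hom [of m n] by simp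
  then show ?thesis
    by (simp add: base_change_theory_def efun_comp_def arity_iso_def base_change_fun_def)
qed

end

section \<open>Theories and models under change of base\<close>

theorem theorem8:
  fixes V :: "('o, 'a) num_cat" and W :: "('p, 'b) num_cat"
    and F :: "('o, 'a, 'p, 'b) func"
    and T :: "(nat, 'o, 'a) ecat" and \<tau> :: "(nat, nat, 'a) efun"
  assumes "num_ccc V" and "num_ccc W"
    and "cartesian_functor V W F" and "preserves_num V W F"
    and "enriched_theory V T \<tau>"
  shows "enriched_theory W (base_change V W F T) (base_change_theory W F \<tau>) \<and>
    (\<forall>(C :: ('c, 'o, 'a) ecat) \<mu>. is_model V T \<tau> C \<mu> \<longrightarrow>
      is_model W (base_change V W F T) (base_change_theory W F \<tau>)
        (base_change V W F C) (base_change_fun F \<mu>))"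
proof -
  interpret arity_base_change V W F
    using assms(1-4)
    by (intro arity_base_change.intro cartesian_base_change.intro
        cartesian_base_change_axioms.intro arity_base_change_axioms.intro)
  have T: "enriched_category V T" and \<tau>: "enriched_functor V (arity_ecat V) T \<tau>"
    and obj: "eobj T = UNIV" "\<And>n. fobj \<tau> n = n"
    and pres: "preserves_finite_eproducts V (arity_ecat V) T \<tau>"
    using assms(5) by (auto simp: enriched_theory_def)
  interpret \<tau>: functor_base_change V W F "arity_ecat V" T \<tau>
    by (intro functor_base_change.intro enriched_functor_over_ccc.intro enriched_over_ccc.intro
        cartesian_base_change_axioms assms(1) V.arity_enriched_category T \<tau>)
  \<comment> \<open>\<open>base_change_arity\<close> turns the source of
    \<open>base_change_fun F \<tau>\<close> into the arity category of W itself.\<close>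
  have FT: "enriched_theory W (base_change V W F T) (base_change_theory W F \<tau>)"
    using \<tau>.D.enriched_category_base_change \<tau>.Ff.enriched_functor_axioms
      \<tau>.preserves_finite_eproducts_base_change [OF pres V.arity_eproduct_exists] obj
    by (simp add: enriched_theory_def base_change_arity base_change_theory_eq [OF \<tau>])
  \<comment> \<open>\<open>\<tau>\<close> is the identity on objects, so every family in
    \<open>T\<close> is a family of arities, and \<open>\<tau>\<close> sends its product cone to one
    on the same family.\<close>
  have T_products: "\<exists>b q. is_eproduct V T b bs q" for bs
  proof -
    obtain b q where "is_eproduct V (arity_ecat V) b bs q"
      using V.arity_eproduct_exists by blast
    then have "is_eproduct V T (fobj \<tau> b) (map (fobj \<tau>) bs) (\<lambda>i. fhom \<tau> b (bs ! i) \<odot>\<^bsub>V\<^esub> q i)"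
      using pres by (simp add: \<tau>.f.preserves_finite_eproducts_iff)
    moreover have "map (fobj \<tau>) bs = bs" by (simp add: obj(2) map_idI)
    ultimately show ?thesis by auto
  qed
  have "is_model W (base_change V W F T) (base_change_theory W F \<tau>)
      (base_change V W F C) (base_change_fun F \<mu>)"
    if "is_model V T \<tau> C \<mu>" for C :: "('c, 'o, 'a) ecat" and \<mu>
  proof -
    have C: "enriched_category V C" and \<mu>: "enriched_functor V T C \<mu>"
      and pres\<mu>: "preserves_finite_eproducts V T C \<mu>"
      using that by (auto simp: is_model_def)
    interpret \<mu>: functor_base_change V W F T C \<mu>
      by (intro functor_base_change.intro enriched_functor_over_ccc.intro enriched_over_ccc.intro
        cartesian_base_change_axioms assms(1) T C \<mu>)
    show ?thesis
      using FT \<mu>.D.enriched_category_base_change \<mu>.Ff.enriched_functor_axioms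
        \<mu>.preserves_finite_eproducts_base_change [OF pres\<mu> T_products]
      by (simp add: is_model_def)
  qed
  with FT show ?thesis by blast
qed

end
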